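(* Let $K\ge1$, let $\ell:\Delta_K\times\{e_1,\dots,e_K\}\to[-1,1]$ be a proper loss, and let $f(p)=\sum_{i=1}^K p_i\,\ell(p,e_i)$ for $p\in\Delta_K$. For a nonzero vector $\alpha\in[0,\infty)^K$ define $F(\alpha)=\mathbb E_{P\sim\operatorname{Dir}(\alpha)}f(P)$. Let $\alpha\in[0,\infty)^K$, let $n=\sum_{i=1}^K\alpha_i$, and suppose $j\in\{1,\dots,K\}$ satisfies $\alpha_j\ge1$. Then $$\mathbb E_{P\sim\operatorname{Dir}(\alpha)}\ell(P,e_j)=n\,F(\alpha)-(n-1)\,F(\alpha-e_j),$$ where, when $n=1$, the second term $(n-1)F(\alpha-e_j)$ is interpreted as zero.
   Context: $\Delta_K=\{p\in\mathbb R^K: p_i\ge 0,\ \sum_i p_i=1\}$ is the probability simplex with vertices $e_1,\dots,e_K$ (standard basis vectors). A loss $\ell:\Delta_K\times\{e_1,\dots,e_K\}\to[-1,1]$ is proper if for every $p\in\Delta_K$, $p$ is a minimizer over $q\in\Delta_K$ of $\sum_{i=1}^K p_i\,\ell(q,e_i)$. No differentiability or continuity of $\ell$ is assumed. For a nonzero vector $\alpha\in[0,\infty)^K$ (real entries, zeros allowed) let $A=\{i:\alpha_i>0\}$. The law $\operatorname{Dir}(\alpha)$ is the distribution of the random vector $P\in\Delta_K$ obtained by drawing independent $G_i\sim\mathrm{Gamma}(\alpha_i,1)$ for $i\in A$, setting $P_i=G_i/\sum_{k\in A}G_k$ for $i\in A$ and $P_i=0$ for $i\notin A$ (so it is supported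 on the face spanned by $\{e_i:i\in A\}$; if $A=\{i\}$ it is the point mass at $e_i$). In particular, if $\alpha_j=1$ then $\operatorname{Dir}(\alpha-e_j)$ lives on the face with coordinate $j$ equal to zero. *)

theory Defs
  imports "HOL-Probability.Probability"
begin

definition prob_simplex :: "(real ^ 'k) set" where
  "prob_simplex = {p. (\<forall>i. 0 \<le> p $ i) \<and> (\<Sum>i\<in>UNIV. p $ i) = 1}"

text \<open>
  A loss is a map on all of the ambient space, of which only the values
  \<open>l p (axis i 1)\<close> for \<open>p\<close> in the simplex are constrained; \<open>axis i 1\<close> is the
  vertex \<open>e\<^sub>i\<close>.
\<close>

definition bounded_loss :: "(real ^ 'k \<Rightarrow> real ^ 'k \<Rightarrow> real) \<Rightarrow> bool" where
  "bounded_loss l \<longleftrightarrow> (\<forall>p\<in>prob_simplex. \<forall>i. l p (axis i 1) \<in> {-1..1})"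

definition expected_loss ::
  "(real ^ 'k \<Rightarrow> real ^ 'k \<Rightarrow> real) \<Rightarrow> real ^ 'k \<Rightarrow> real ^ 'k \<Rightarrow> real" where
  "expected_loss l p q = (\<Sum>i\<in>UNIV. p $ i * l q (axis i 1))"

definition proper_loss :: "(real ^ 'k \<Rightarrow> real ^ 'k \<Rightarrow> real) \<Rightarrow> bool" where
  "proper_loss l \<longleftrightarrow>
     (\<forall>p\<in>prob_simplex. \<forall>q\<in>prob_simplex. expected_loss l p p \<le> expected_loss l p q)"

definition bayes_risk :: "(real ^ 'k \<Rightarrow> real ^ 'k \<Rightarrow> real) \<Rightarrow> real ^ 'k \<Rightarrow> real" where
  "bayes_risk l p = expected_loss l p p"

definition gamma_density :: "real \<Rightarrow> real \<Rightarrow> real" where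
  "gamma_density a x = (if x > 0 then x powr (a - 1) * exp (- x) / Gamma a else 0)"

definition gamma_measure :: "real \<Rightarrow> real measure" where
  "gamma_measure a = density lborel (\<lambda>x. ennreal (gamma_density a x))"

text \<open>
  Only meaningful for nonzero \<open>\<alpha>\<close> with nonnegative entries. The normalising sum is
  positive almost surely, so division by zero plays no role.
\<close>

definition dirichlet :: "real ^ 'k \<Rightarrow> (real ^ 'k) measure" where
  "dirichlet \<alpha> =
     (let A = {i. \<alpha> $ i > 0} in
      distr (\<Pi>\<^sub>M i\<in>A. gamma_measure (\<alpha> $ i)) borel
        (\<lambda>G. \<chi> i. if i \<in> A then G i / (\<Sum>k\<in>A. G k) else 0))"

text \<open>
  A proper loss need not be Borel measurable: at points where the Bayes risk is not
  differentiable its value is an arbitrary choice of supergradient. Expectations are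
  therefore taken with respect to the completed law, for which null sets
  (including everything outside the simplex) do not matter.
\<close>

abbreviation dirichlet_completed :: "real ^ 'k \<Rightarrow> (real ^ 'k) measure" where
  "dirichlet_completed \<alpha> \<equiv> completion (dirichlet \<alpha>)"

definition dirichlet_bayes_risk ::
  "(real ^ 'k \<Rightarrow> real ^ 'k \<Rightarrow> real) \<Rightarrow> real ^ 'k \<Rightarrow> real" where
  "dirichlet_bayes_risk l \<alpha> = (\<integral>p. bayes_risk l p \<partial>dirichlet_completed \<alpha>)"

end

theory Submission
  imports Defs
begin

text \<open>
  Let \<open>H\<close> be the 1-homogeneous extension of the Bayes risk \<open>f\<close> to the orthant. It is concave and
  1-Lipschitz, with supergradient \<open>l (x / |x|)\<close> at \<open>x\<close>, so along coordinate \<open>j\<close> the loss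
  \<open>l (x / |x|) e\<^sub>j\<close> is the partial derivative of \<open>H\<close> except at countably many points. For independent
  gamma variables \<open>G\<close> with shapes \<open>\<alpha>\<close>, integration by parts in \<open>G\<^sub>j\<close> turns the expected loss into
  \<open>E H(G\<^sup>\<alpha>) - E H(G\<^sup>\<beta>)\<close> with \<open>\<beta> = \<alpha> - e\<^sub>j\<close>. Since \<open>H (G) = |G| f (G / |G|)\<close> and \<open>|G|\<close>, of mean \<open>n\<close>,
  is independent of \<open>G / |G|\<close>, these two terms are \<open>n F(\<alpha>)\<close> and \<open>(n - 1) F(\<beta>)\<close>.
\<close>

subsection \<open>Gamma distributions\<close>

text \<open>The obstacle is measurability: a proper loss need not be Borel, so Fubini and the
  passage between \<open>G\<close> and \<open>G / |G|\<close> cannot be applied to \<open>l\<close>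
  directly. Its Borel substitute is \<open>left_deriv\<close>, a limit of difference quotients of
  the homogeneous extension. The exceptional set is described without \<open>l\<close>, as the
  points where the left quotient minus the right quotient does not tend to 0. This set is Borel and
  meets each half-line parallel to axis \<open>j\<close> in a countable set, so Fubini makes it
  null; outside it, properness squeezes the loss between the two quotients. Since the quotients are
  invariant under scaling, the same criterion serves the gamma variables, where Fubini works, and
  the simplex, where the loss lives.\<close>

lemma gamma_density_nonneg: "0 < a \<Longrightarrow> 0 \<le> gamma_density a x"
  by (simp add: gamma_density_def Gamma_real_pos less_imp_le)

lemma borel_measurable_gamma_density [measurable]: "gamma_density a \<in> borel_measurable borel"
  unfolding gamma_density_def by measurable

lemma sets_gamma_measure [measurable_cong, simp]: "sets (gamma_measure a) = sets borel"
  by (simp add: gamma_measure_def)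

lemma space_gamma_measure [simp]: "space (gamma_measure a) = UNIV"
  by (simp add: gamma_measure_def)

lemma prob_space_gamma_measure:
  assumes "0 < a"
  shows "prob_space (gamma_measure a)"
proof
  have G: "0 < Gamma a" using assms by (rule Gamma_real_pos)
  have "emeasure (gamma_measure a) (space (gamma_measure a)) = (\<integral>\<^sup>+x. ennreal (gamma_density a x) \<partial>lborel)"
    by (simp add: gamma_measure_def emeasure_density)
  also have "\<dots> = (\<integral>\<^sup>+x. ennreal (1 / Gamma a) * ennreal (indicator {0..} x * x powr (a - 1) / exp x) \<partial>lborel)"
    by (intro nn_integral_cong_AE AE_I[where N="{0}"])
       (use G in \<open>auto simp: gamma_density_def ennreal_mult'[symmetric] exp_minus field_simps split: split_indicator\<close>)
  also have "\<dots> = ennreal (1 / Gamma a) * ennreal (Gamma a)"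
    using assms by (simp add: nn_integral_cmult Gamma_conv_nn_integral_real)
  also have "\<dots> = 1" using G by (simp add: ennreal_mult'[symmetric])
  finally show "emeasure (gamma_measure a) (space (gamma_measure a)) = 1" .
qed

lemma AE_gamma_measure_pos: "AE x in gamma_measure a. 0 < x"
  unfolding gamma_measure_def by (subst AE_density) (auto simp: gamma_density_def)

lemma AE_gamma_measure_countable:
  assumes "countable N"
  shows "AE x in gamma_measure a. x \<notin> N"
proof -
  have "AE x in lborel. x \<notin> N"
    by (intro AE_not_in countable_imp_null_set_lborel assms)
  thus ?thesis unfolding gamma_measure_def by (subst AE_density) auto
qed

text \<open>Both sides are the gamma law of rate \<open>1 + c\<close>, once as an exponential tilt
  and once as a rescaling. The tilt is used twice: to move a scaling from the test function to the
  density, and to separate the sum of gamma variables from their ratios.\<close>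

lemma gamma_measure_scale:
  assumes "0 < a" "0 < c"
  shows "density (gamma_measure a) (\<lambda>x. ennreal ((1 + c) powr a * exp (- (c * x))))
    = distr (gamma_measure a) borel (\<lambda>x. x / (1 + c))"
proof (rule measure_eqI)
  fix X assume "X \<in> sets (density (gamma_measure a) (\<lambda>x. ennreal ((1 + c) powr a * exp (- (c * x)))))"
  hence X [measurable]: "X \<in> sets borel" by simp
  have *: "gamma_density a ((1 + c) * x) * (1 + c) = gamma_density a x * ((1 + c) powr a * exp (- (c * x)))" for x
  proof (cases "0 < x")
    case True
    have "exp (- ((1 + c) * x)) = exp (- x) * exp (- (c * x))"
      by (simp add: exp_add[symmetric] algebra_simps)
    moreover have "(1 + c) powr a = (1 + c) powr (a - 1) * (1 + c)"
      using assms by (simp add: powr_diff)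
    ultimately show ?thesis
      using assms True by (simp add: gamma_density_def powr_mult mult_ac)
  next
    case False
    hence "\<not> 0 < (1 + c) * x" using assms by (simp add: zero_less_mult_iff)
    thus ?thesis using False by (simp add: gamma_density_def)
  qed
  have "emeasure (distr (gamma_measure a) borel (\<lambda>x. x / (1 + c))) X
      = (\<integral>\<^sup>+x. indicator X (x / (1 + c)) \<partial>gamma_measure a)"
    by (subst nn_integral_indicator[symmetric]) (auto simp: nn_integral_distr simp del: nn_integral_indicator)
  also have "\<dots> = (\<integral>\<^sup>+x. ennreal (gamma_density a x) * indicator X (x / (1 + c)) \<partial>lborel)"
    unfolding gamma_measure_def by (subst nn_integral_density) auto
  also have "\<dots> = ennreal (1 + c) * (\<integral>\<^sup>+x. ennreal (gamma_density a ((1 + c) * x)) * indicator X x \<partial>lborel)"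
    using assms by (subst nn_integral_real_affine[where c="1 + c" and t=0]) auto
  also have "\<dots> = (\<integral>\<^sup>+x. ennreal (gamma_density a ((1 + c) * x) * (1 + c)) * indicator X x \<partial>lborel)"
    using assms by (subst nn_integral_cmult[symmetric])
      (auto simp: ennreal_mult gamma_density_nonneg mult_ac)
  also have "\<dots> = (\<integral>\<^sup>+x. ennreal (gamma_density a x) * (ennreal ((1 + c) powr a * exp (- (c * x))) * indicator X x) \<partial>lborel)"
    unfolding * using assms by (intro nn_integral_cong) (auto simp: ennreal_mult gamma_density_nonneg mult_ac)
  also have "\<dots> = emeasure (density (gamma_measure a) (\<lambda>x. ennreal ((1 + c) powr a * exp (- (c * x))))) X"
    by (subst emeasure_density) (auto simp: gamma_measure_def nn_integral_density)
  finally show "emeasure (density (gamma_measure a) (\<lambda>x. ennreal ((1 + c) powr a * exp (- (c * x))))) X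
      = emeasure (distr (gamma_measure a) borel (\<lambda>x. x / (1 + c))) X" ..
qed simp

lemma mult_gamma_density:
  assumes "0 < a" shows "x * gamma_density a x = a * gamma_density (a + 1) x"
proof -
  have "Gamma (a + 1) = a * Gamma a" "0 < Gamma a"
    using assms by (auto intro!: Gamma_plus1 Gamma_real_pos elim: nonpos_Ints_cases)
  thus ?thesis using assms by (auto simp: gamma_density_def powr_diff field_simps)
qed

text \<open>Size biasing raises the shape by one because \<open>Gamma (a + 1) = a * Gamma a\<close>.
  Read from right to left, it is how the lowered shape enters the integration by parts.\<close>

lemma
  assumes "0 < a" and [measurable]: "f \<in> borel_measurable borel"
  shows integrable_gamma_measure_Suc:
      "integrable (gamma_measure a) (\<lambda>x. x * f x) \<longleftrightarrow> integrable (gamma_measure (a + 1)) f"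
    and integral_gamma_measure_Suc:
      "(\<integral>x. x * f x \<partial>gamma_measure a) = a * (\<integral>x. f x \<partial>gamma_measure (a + 1))"
proof -
  have *: "gamma_density a x * (x * f x) = a * (gamma_density (a + 1) x * f x)" for x
    using mult_gamma_density[OF assms(1), of x] by (simp add: mult_ac)
  show "integrable (gamma_measure a) (\<lambda>x. x * f x) \<longleftrightarrow> integrable (gamma_measure (a + 1)) f"
    unfolding gamma_measure_def using assms
    by (simp add: integrable_real_density gamma_density_nonneg *)
  show "(\<integral>x. x * f x \<partial>gamma_measure a) = a * (\<integral>x. f x \<partial>gamma_measure (a + 1))"
    unfolding gamma_measure_def using assms
    by (simp add: integral_real_density gamma_density_nonneg *)
qed

lemma integrable_gamma_measure_ident:
  assumes "0 < a" shows "integrable (gamma_measure a) (\<lambda>x. x)"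
proof -
  interpret prob_space "gamma_measure (a + 1)" using assms by (intro prob_space_gamma_measure) simp
  show ?thesis using integrable_gamma_measure_Suc[OF assms, of "\<lambda>_. 1"] by simp
qed

text \<open>All limits in the step size run along \<open>1 / Suc k\<close>, because dominated
  convergence and the measurability of limits are statements about sequences.\<close>

lemma tendsto_difference_quotient_seq:
  fixes f :: "real \<Rightarrow> real"
  assumes "(f has_real_derivative D) (at 0)"
  shows "(\<lambda>k. (f (1 / real (Suc k)) - f 0) / (1 / real (Suc k))) \<longlonglongrightarrow> D"
proof -
  have "((\<lambda>h. (f h - f 0) / h) \<longlongrightarrow> D) (at 0)"
    using assms by (simp add: has_field_derivative_iff)
  moreover have "filterlim (\<lambda>k. 1 / real (Suc k)) (at 0) sequentially"
    unfolding filterlim_at using LIMSEQ_inverse_real_of_nat by (simp add: divide_inverse)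
  ultimately show ?thesis by (rule filterlim_compose)
qed

text \<open>
  Integration by parts against the gamma density, whose derivative is
  \<open>gamma_density (a - 1) - gamma_density a\<close>. Using difference quotients with step proportional to \<open>t\<close>,
  the scaling law moves the shift from \<open>g\<close> to the density, so that no regularity of \<open>g\<close> is needed and
  the boundary term at \<open>0\<close> appears by itself when \<open>a = 1\<close>.
\<close>

lemma gamma_measure_difference_quotient:
  fixes g D :: "real \<Rightarrow> real" and c :: "nat \<Rightarrow> real"
  defines "c \<equiv> \<lambda>k. 1 / real (Suc k)"
  assumes a: "1 \<le> a" and [measurable]: "g \<in> borel_measurable borel" "D \<in> borel_measurable borel"
    and g0: "\<And>t. 0 < t \<Longrightarrow> \<bar>g t - g 0\<bar> \<le> t"
    and quot: "\<And>k t. 0 < t \<Longrightarrow> \<bar>(g t - g (t / (1 + c k))) / (t - t / (1 + c k))\<bar> \<le> 1"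
    and lim: "AE t in gamma_measure a. (\<lambda>k. (g t - g (t / (1 + c k))) / (t - t / (1 + c k))) \<longlonglongrightarrow> D t"
  shows "(\<integral>t. D t \<partial>gamma_measure a) =
    (\<integral>t. g t \<partial>gamma_measure a) - (if a = 1 then g 0 else \<integral>t. g t \<partial>gamma_measure (a - 1))"
proof -
  interpret prob_space "gamma_measure a" using a by (intro prob_space_gamma_measure) simp
  have c: "0 < c k" "c k \<le> 1" for k by (auto simp: c_def)
  \<comment> \<open>Dividing by \<open>t\<close> gives a function bounded by 1 on the positive axis,
    hence integrable for every shape. The identity \<open>t * \<phi> t = g t - g 0\<close> holds at
    \<open>t = 0\<close> as well, both sides being 0 there.\<close>
  define \<phi> where "\<phi> t = (g t - g 0) / t" for t
  have [measurable]: "\<phi> \<in> borel_measurable borel" unfolding \<phi>_def by measurable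
  have \<phi>_le: "0 < t \<Longrightarrow> \<bar>\<phi> t\<bar> \<le> 1" for t
    using g0[of t] by (simp add: \<phi>_def abs_divide)
  have mult_\<phi>: "t * \<phi> t = g t - g 0" for t
    by (simp add: \<phi>_def)
  define Q where "Q k t = (g t - g (t / (1 + c k))) / (t - t / (1 + c k))" for k t
  have [measurable]: "Q k \<in> borel_measurable borel" for k
    unfolding Q_def by measurable
  define R where "R k t = ((1 + c k) - (1 + c k) powr a * exp (- (c k * t))) / c k" for k t
  have [measurable]: "R k \<in> borel_measurable borel" for k
    unfolding R_def by measurable
  have \<phi>_int: "integrable (gamma_measure a) \<phi>"
    by (rule integrable_const_bound[where B=1]) (use AE_gamma_measure_pos[of a] \<phi>_le in auto)
  have t\<phi>_int: "integrable (gamma_measure a) (\<lambda>t. t * \<phi> t)"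
    by (rule Bochner_Integration.integrable_bound[OF integrable_gamma_measure_ident[of a]])
       (use a AE_gamma_measure_pos[of a] g0 in \<open>auto simp: mult_\<phi>\<close>)
  have scaled_int: "integrable (gamma_measure a) (\<lambda>t. \<phi> (t / (1 + c k)))" for k
    by (rule integrable_const_bound[where B=1])
       (use AE_gamma_measure_pos[of a] \<phi>_le c[of k] in auto)
  \<comment> \<open>In terms of \<open>\<phi>\<close> the quotient is
    \<open>((1 + c) * \<phi> t - \<phi> (t / (1 + c))) / c\<close>. The scaling law turns the second
    summand into a tilted integral of \<open>\<phi> t\<close>, and \<open>R k\<close> collects the
    resulting weight.\<close>
  have eq: "(\<integral>t. Q k t \<partial>gamma_measure a) = (\<integral>t. \<phi> t * R k t \<partial>gamma_measure a)" for k
  proof -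
    note ck = c[of k]
    have "(\<integral>t. Q k t \<partial>gamma_measure a)
        = (\<integral>t. ((1 + c k) * \<phi> t - \<phi> (t / (1 + c k))) / c k \<partial>gamma_measure a)"
    proof (intro integral_cong_AE)
      show "AE t in gamma_measure a. Q k t = ((1 + c k) * \<phi> t - \<phi> (t / (1 + c k))) / c k"
        using AE_gamma_measure_pos[of a]
      proof eventually_elim
        case (elim t)
        have "t - t / (1 + c k) = t * c k / (1 + c k)" using ck by (simp add: field_simps)
        thus ?case using elim ck unfolding Q_def \<phi>_def
          by (simp add: field_simps)
      qed
    qed auto
    also have "\<dots> = ((1 + c k) * (\<integral>t. \<phi> t \<partial>gamma_measure a) - (\<integral>t. \<phi> (t / (1 + c k)) \<partial>gamma_measure a)) / c k"
      using \<phi>_int scaled_int[of k] by simp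
    also have "(\<integral>t. \<phi> (t / (1 + c k)) \<partial>gamma_measure a) = (\<integral>t. \<phi> t \<partial>distr (gamma_measure a) borel (\<lambda>t. t / (1 + c k)))"
      by (simp add: integral_distr)
    also have "\<dots> = (\<integral>t. ((1 + c k) powr a * exp (- (c k * t))) * \<phi> t \<partial>gamma_measure a)"
      using a ck by (subst gamma_measure_scale[symmetric]) (auto simp: integral_real_density)
    also have "((1 + c k) * (\<integral>t. \<phi> t \<partial>gamma_measure a) - \<dots>) / c k = (\<integral>t. \<phi> t * R k t \<partial>gamma_measure a)"
    proof -
      have "integrable (gamma_measure a) (\<lambda>t. ((1 + c k) powr a * exp (- (c k * t))) * \<phi> t)"
      proof -
        have "integrable (distr (gamma_measure a) borel (\<lambda>t. t / (1 + c k))) \<phi>"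
          using scaled_int[of k] by (simp add: integrable_distr_eq)
        thus ?thesis
          using a ck by (subst (asm) gamma_measure_scale[symmetric]) (auto simp: integrable_real_density)
      qed
      hence "(1 + c k) * (\<integral>t. \<phi> t \<partial>gamma_measure a) - (\<integral>t. ((1 + c k) powr a * exp (- (c k * t))) * \<phi> t \<partial>gamma_measure a)
          = (\<integral>t. (1 + c k) * \<phi> t - ((1 + c k) powr a * exp (- (c k * t))) * \<phi> t \<partial>gamma_measure a)"
        using \<phi>_int by simp
      thus ?thesis unfolding R_def
        by (simp add: algebra_simps diff_divide_distrib flip: integral_divide_zero)
    qed
    finally show ?thesis .
  qed
  have lim_D: "(\<lambda>k. \<integral>t. Q k t \<partial>gamma_measure a) \<longlonglongrightarrow> (\<integral>t. D t \<partial>gamma_measure a)"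
    by (rule integral_dominated_convergence[where w="\<lambda>_. 1"])
       (use lim AE_gamma_measure_pos[of a] quot in \<open>auto simp: Q_def\<close>)
  \<comment> \<open>The constant \<open>B\<close> of the dominating function comes from here: these
    quotients converge, so they are bounded in \<open>k\<close>.\<close>
  have "((\<lambda>h. (1 + h) powr a) has_real_derivative a) (at 0)"
    by (auto intro!: derivative_eq_intros)
  from tendsto_difference_quotient_seq[OF this]
  have "(\<lambda>k. ((1 + c k) powr a - 1) / c k) \<longlonglongrightarrow> a"
    by (simp only: c_def add_0_right powr_one_eq_one)
  hence "Bseq (\<lambda>k. ((1 + c k) powr a - 1) / c k)"
    by (intro convergent_imp_Bseq convergentI)
  then obtain B where B: "\<And>k. \<bar>((1 + c k) powr a - 1) / c k\<bar> \<le> B"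
    unfolding Bseq_def real_norm_def by blast
  \<comment> \<open>For \<open>t > 0\<close> the limit is \<open>- t\<close> times the logarithmic
    derivative of the gamma density of shape \<open>a\<close>. Integrated against
    \<open>\<phi>\<close>, it is therefore minus the integral of \<open>g t - g 0\<close> against
    the derivative of the density.\<close>
  have R_lim: "(\<lambda>k. R k t) \<longlonglongrightarrow> t - (a - 1)" for t
  proof -
    have "((\<lambda>h. (1 + h) - (1 + h) powr a * exp (- (h * t))) has_real_derivative (1 - (a - t))) (at 0)"
      by (auto intro!: derivative_eq_intros)
    from tendsto_difference_quotient_seq[OF this] show ?thesis
      unfolding R_def c_def by (simp add: algebra_simps)
  qed
  have R_le: "\<bar>R k t\<bar> \<le> 1 + B + 2 powr a * t" if "0 < t" for k t
  proof -
    note ck = c[of k]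
    have "R k t = 1 - ((1 + c k) powr a - 1) / c k + (1 + c k) powr a * ((1 - exp (- (c k * t))) / c k)"
      using ck unfolding R_def by (simp add: field_simps)
    moreover have "\<bar>(1 + c k) powr a * ((1 - exp (- (c k * t))) / c k)\<bar> \<le> 2 powr a * t"
    proof -
      have "1 - exp (- (c k * t)) \<le> c k * t" using exp_ge_add_one_self[of "- (c k * t)"] by simp
      hence "(1 - exp (- (c k * t))) / c k \<le> t" using ck by (simp add: field_simps)
      moreover have nn: "0 \<le> (1 - exp (- (c k * t))) / c k" using ck that by simp
      moreover have "(1 + c k) powr a \<le> 2 powr a" using ck a by (intro powr_mono2) auto
      ultimately have "(1 + c k) powr a * ((1 - exp (- (c k * t))) / c k) \<le> 2 powr a * t"
        by (intro mult_mono) auto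
      moreover have "0 \<le> (1 + c k) powr a * ((1 - exp (- (c k * t))) / c k)"
        using nn by (intro mult_nonneg_nonneg) auto
      ultimately show ?thesis by (simp only: abs_of_nonneg)
    qed
    ultimately show ?thesis using B[of k] by linarith
  qed
  have "(\<lambda>k. \<integral>t. \<phi> t * R k t \<partial>gamma_measure a) \<longlonglongrightarrow> (\<integral>t. \<phi> t * (t - (a - 1)) \<partial>gamma_measure a)"
  proof (rule integral_dominated_convergence[where w="\<lambda>t. 1 + B + 2 powr a * t"])
    show "integrable (gamma_measure a) (\<lambda>t. 1 + B + 2 powr a * t)"
      using a integrable_gamma_measure_ident[of a] by auto
    show "AE t in gamma_measure a. (\<lambda>k. \<phi> t * R k t) \<longlonglongrightarrow> \<phi> t * (t - (a - 1))"
      by (intro AE_I2 tendsto_mult tendsto_const R_lim)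
    show "AE t in gamma_measure a. norm (\<phi> t * R k t) \<le> 1 + B + 2 powr a * t" for k
      using AE_gamma_measure_pos[of a]
    proof eventually_elim
      case (elim t)
      have "\<bar>\<phi> t\<bar> * \<bar>R k t\<bar> \<le> 1 * \<bar>R k t\<bar>"
        by (intro mult_right_mono \<phi>_le elim) simp
      thus ?case using R_le[OF elim, of k] by (simp add: abs_mult)
    qed
  qed auto
  with lim_D eq have "(\<integral>t. D t \<partial>gamma_measure a) = (\<integral>t. \<phi> t * (t - (a - 1)) \<partial>gamma_measure a)"
    by (auto intro: LIMSEQ_unique)
  also have "\<dots> = (\<integral>t. t * \<phi> t - (a - 1) * \<phi> t \<partial>gamma_measure a)"
    by (simp add: algebra_simps)
  also have "\<dots> = (\<integral>t. t * \<phi> t \<partial>gamma_measure a) - (a - 1) * (\<integral>t. \<phi> t \<partial>gamma_measure a)"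
    using t\<phi>_int \<phi>_int by simp
  also have g_int: "integrable (gamma_measure a) g"
  proof -
    have "integrable (gamma_measure a) (\<lambda>t. t * \<phi> t + g 0)" using t\<phi>_int by simp
    thus ?thesis by (simp add: mult_\<phi>)
  qed
  hence "(\<integral>t. t * \<phi> t \<partial>gamma_measure a) = (\<integral>t. g t \<partial>gamma_measure a) - g 0"
    by (simp add: mult_\<phi> prob_space[simplified])
  \<comment> \<open>For \<open>a = 1\<close> the factor vanishes and the \<open>g 0\<close> of the
    preceding step survives as boundary term. Otherwise size biasing leads to shape
    \<open>a - 1 > 0\<close>, and the two copies of \<open>g 0\<close> cancel.\<close>
  also have "(a - 1) * (\<integral>t. \<phi> t \<partial>gamma_measure a)
      = (if a = 1 then 0 else (\<integral>t. g t \<partial>gamma_measure (a - 1)) - g 0)"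
  proof (cases "a = 1")
    case False
    with a have a1: "0 < a - 1" by simp
    interpret a1: prob_space "gamma_measure (a - 1)" using a1 by (rule prob_space_gamma_measure)
    have "integrable (gamma_measure (a - 1)) (\<lambda>t. t * \<phi> t)"
      using integrable_gamma_measure_Suc[OF a1, of \<phi>] \<phi>_int by simp
    hence "integrable (gamma_measure (a - 1)) (\<lambda>t. t * \<phi> t + g 0)" by simp
    hence "integrable (gamma_measure (a - 1)) g" by (simp add: mult_\<phi>)
    moreover have "(a - 1) * (\<integral>t. \<phi> t \<partial>gamma_measure a) = (\<integral>t. g t - g 0 \<partial>gamma_measure (a - 1))"
      using integral_gamma_measure_Suc[OF a1, of \<phi>] by (simp add: mult_\<phi>)
    ultimately show ?thesis using False by (simp add: a1.prob_space[simplified])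
  qed simp
  finally show ?thesis by simp
qed

subsection \<open>Products of gamma distributions\<close>

text \<open>Shapes are positive at every index, so that \<open>product_sigma_finite\<close> holds
  for the whole family; faces of the simplex are handled by the index set \<open>A\<close> of the
  product.\<close>

locale gamma_product =
  fixes a :: "'i \<Rightarrow> real"
  assumes shape_pos: "0 < a i"
begin

abbreviation M :: "'i \<Rightarrow> real measure" where
  "M i \<equiv> gamma_measure (a i)"

lemma prob_space_M: "prob_space (M i)"
  by (intro prob_space_gamma_measure shape_pos)

lemma prob_space_product: "prob_space (Pi\<^sub>M A M)"
  by (intro prob_space_PiM prob_space_M)

sublocale product_sigma_finite M
  unfolding product_sigma_finite_def by (intro allI prob_space_imp_sigma_finite prob_space_M)

text \<open>Null fibres yield a null set only for a measurable predicate. This is why exceptional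
  sets are later phrased through Borel quotients and not through the loss.\<close>

lemma AE_insert:
  assumes A: "finite A" "i \<notin> A" and [measurable]: "Measurable.pred (Pi\<^sub>M (insert i A) M) P"
    and AE: "AE G in Pi\<^sub>M A M. AE t in M i. P (G(i := t))"
  shows "AE G in Pi\<^sub>M (insert i A) M. P G"
proof -
  have meas: "Measurable.pred (M i) (\<lambda>t. P (G(i := t)))" if "G \<in> space (Pi\<^sub>M A M)" for G
    using measurable_compose[OF measurable_fun_upd[OF _ measurable_const[OF that] measurable_ident] assms(3)]
    by simp
  have "emeasure (Pi\<^sub>M (insert i A) M) {G \<in> space (Pi\<^sub>M (insert i A) M). \<not> P G}
      = (\<integral>\<^sup>+G. indicator {G. \<not> P G} G \<partial>Pi\<^sub>M (insert i A) M)"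
    by (subst nn_integral_indicator[symmetric])
       (auto intro!: nn_integral_cong simp del: nn_integral_indicator split: split_indicator)
  also have "\<dots> = (\<integral>\<^sup>+G. \<integral>\<^sup>+t. indicator {G. \<not> P G} (G(i := t)) \<partial>M i \<partial>Pi\<^sub>M A M)"
    by (rule product_nn_integral_insert) (use A in auto)
  also have "\<dots> = (\<integral>\<^sup>+G. 0 \<partial>Pi\<^sub>M A M)"
  proof (intro nn_integral_cong_AE)
    show "AE G in Pi\<^sub>M A M. (\<integral>\<^sup>+t. indicator {G. \<not> P G} (G(i := t)) \<partial>M i) = 0"
      using AE
    proof eventually_elim
      case (elim G)
      hence "(\<integral>\<^sup>+t. indicator {G. \<not> P G} (G(i := t)) \<partial>M i) = (\<integral>\<^sup>+t. 0 \<partial>M i)"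
        by (intro nn_integral_cong_AE) (auto elim!: eventually_mono)
      thus ?case by simp
    qed
  qed
  finally show ?thesis by (subst AE_iff_measurable[OF _ refl]) auto
qed

text \<open>The tilt factorises over the coordinates, so the one-dimensional law applies to one
  coordinate at a time. The function \<open>f\<close> is arbitrary in the induction because the
  hypothesis is applied to the inner integral over the new coordinate. Nonnegative integrals avoid
  integrability conditions.\<close>

lemma nn_integral_scale:
  fixes c :: real
  assumes A: "finite A" and c: "0 < c" and f: "f \<in> borel_measurable (Pi\<^sub>M A M)"
  shows "(\<integral>\<^sup>+G. ennreal ((1 + c) powr (\<Sum>i\<in>A. a i) * exp (- (c * (\<Sum>i\<in>A. G i)))) * f G \<partial>Pi\<^sub>M A M)
    = (\<integral>\<^sup>+G. f (\<lambda>i\<in>A. G i / (1 + c)) \<partial>Pi\<^sub>M A M)"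
  using A f
proof (induction A arbitrary: f rule: finite_induct)
  case empty
  thus ?case using c by (simp add: PiM_empty nn_integral_count_space_finite restrict_def)
next
  case (insert i A)
  note [measurable] = insert.prems
  let ?w = "\<lambda>A G. ennreal ((1 + c) powr (\<Sum>i\<in>A. a i) * exp (- (c * (\<Sum>i\<in>A. G i))))"
  let ?v = "\<lambda>t. ennreal ((1 + c) powr a i * exp (- (c * t)))"
  have scale1: "(\<integral>\<^sup>+t. ?v t * h t \<partial>M i) = (\<integral>\<^sup>+t. h (t / (1 + c)) \<partial>M i)"
    if [measurable]: "h \<in> borel_measurable borel" for h
  proof -
    have "(\<integral>\<^sup>+t. ?v t * h t \<partial>M i) = (\<integral>\<^sup>+t. h t \<partial>density (M i) ?v)"
      by (simp add: nn_integral_density)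
    thus ?thesis
      using c by (simp add: gamma_measure_scale shape_pos nn_integral_distr)
  qed
  have upd [measurable]: "(\<lambda>(G, t). f (G(i := t))) \<in> borel_measurable (Pi\<^sub>M A M \<Otimes>\<^sub>M borel)"
    unfolding case_prod_unfold
    by (rule measurable_compose[OF measurable_fun_upd[where J=A and M=M] insert.prems]) auto
  have upd1: "(\<lambda>t. f (G(i := t))) \<in> borel_measurable borel" if "G \<in> space (Pi\<^sub>M A M)" for G
    using measurable_compose[OF measurable_Pair1'[OF that] upd] by simp
  have upd_scaled: "(\<lambda>(G, t). f (G(i := t / (1 + c)))) \<in> borel_measurable (Pi\<^sub>M A M \<Otimes>\<^sub>M M i)"
    unfolding case_prod_unfold
    by (rule measurable_compose[OF measurable_fun_upd[where J=A and M=M] insert.prems]) auto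
  have "(\<integral>\<^sup>+G. ?w (insert i A) G * f G \<partial>Pi\<^sub>M (insert i A) M)
      = (\<integral>\<^sup>+G. \<integral>\<^sup>+t. ?w (insert i A) (G(i := t)) * f (G(i := t)) \<partial>M i \<partial>Pi\<^sub>M A M)"
    by (rule product_nn_integral_insert[OF insert.hyps]) measurable
  also have "\<dots> = (\<integral>\<^sup>+G. ?w A G * (\<integral>\<^sup>+t. f (G(i := t / (1 + c))) \<partial>M i) \<partial>Pi\<^sub>M A M)"
  proof (intro nn_integral_cong)
    fix G assume G: "G \<in> space (Pi\<^sub>M A M)"
    note [measurable] = upd1[OF G]
    have "(\<Sum>k\<in>A. if k = i then t else G k) = (\<Sum>k\<in>A. G k)" for t
      using insert.hyps by (intro sum.cong) auto
    hence "?w (insert i A) (G(i := t)) = ?w A G * ?v t" for t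
      using insert.hyps c
      by (simp add: powr_add distrib_left mult_exp_exp ennreal_mult'[symmetric] mult_ac
          flip: exp_add)
    hence "(\<integral>\<^sup>+t. ?w (insert i A) (G(i := t)) * f (G(i := t)) \<partial>M i)
        = (\<integral>\<^sup>+t. ?w A G * (?v t * f (G(i := t))) \<partial>M i)"
      by (simp add: mult_ac)
    also have "\<dots> = ?w A G * (\<integral>\<^sup>+t. ?v t * f (G(i := t)) \<partial>M i)"
      by (rule nn_integral_cmult) measurable
    finally show "(\<integral>\<^sup>+t. ?w (insert i A) (G(i := t)) * f (G(i := t)) \<partial>M i)
        = ?w A G * (\<integral>\<^sup>+t. f (G(i := t / (1 + c))) \<partial>M i)"
      by (simp add: scale1 upd1[OF G])
  qed
  also have "\<dots> = (\<integral>\<^sup>+G. \<integral>\<^sup>+t. f ((\<lambda>k\<in>A. G k / (1 + c))(i := t / (1 + c))) \<partial>M i \<partial>Pi\<^sub>M A M)"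
    by (rule insert.IH) (rule sigma_finite_measure.borel_measurable_nn_integral[OF sigma_finite_measures upd_scaled])
  also have "\<dots> = (\<integral>\<^sup>+G. \<integral>\<^sup>+t. f (\<lambda>k\<in>insert i A. (G(i := t)) k / (1 + c)) \<partial>M i \<partial>Pi\<^sub>M A M)"
    using insert.hyps by (intro nn_integral_cong arg_cong[where f=f]) (auto simp: fun_eq_iff)
  also have "\<dots> = (\<integral>\<^sup>+G. f (\<lambda>k\<in>insert i A. G k / (1 + c)) \<partial>Pi\<^sub>M (insert i A) M)"
    by (rule product_nn_integral_insert[symmetric, OF insert.hyps]) measurable
  finally show ?case .
qed

lemma measure_scale:
  assumes A: "finite A" and c: "0 < c"
  shows "density (Pi\<^sub>M A M) (\<lambda>G. ennreal ((1 + c) powr (\<Sum>i\<in>A. a i) * exp (- (c * (\<Sum>i\<in>A. G i)))))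
    = distr (Pi\<^sub>M A M) (Pi\<^sub>M A M) (\<lambda>G. \<lambda>i\<in>A. G i / (1 + c))" (is "density _ ?w = distr _ _ ?T")
proof (rule measure_eqI)
  fix X assume "X \<in> sets (density (Pi\<^sub>M A M) ?w)"
  hence [measurable]: "X \<in> sets (Pi\<^sub>M A M)" by simp
  have "emeasure (density (Pi\<^sub>M A M) ?w) X = (\<integral>\<^sup>+G. ?w G * indicator X G \<partial>Pi\<^sub>M A M)"
    by (rule emeasure_density) measurable
  also have "\<dots> = (\<integral>\<^sup>+G. indicator X (?T G) \<partial>Pi\<^sub>M A M)"
    by (rule nn_integral_scale) (use A c in auto)
  also have "\<dots> = (\<integral>\<^sup>+G. indicator X G \<partial>distr (Pi\<^sub>M A M) (Pi\<^sub>M A M) ?T)"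
    by (subst nn_integral_distr) measurable
  finally show "emeasure (density (Pi\<^sub>M A M) ?w) X = emeasure (distr (Pi\<^sub>M A M) (Pi\<^sub>M A M) ?T) X"
    by simp
qed simp

lemma AE_pos: "finite A \<Longrightarrow> AE G in Pi\<^sub>M A M. \<forall>i\<in>A. 0 < G i"
  by (intro AE_finite_allI AE_PiM_component prob_space_M AE_gamma_measure_pos)

lemma integrable_component: "i \<in> A \<Longrightarrow> integrable (Pi\<^sub>M A M) (\<lambda>G. G i)"
  using integrable_distr[of "\<lambda>G. G i" "Pi\<^sub>M A M" "M i" "\<lambda>t. t"]
    distr_PiM_component[of A M i] integrable_gamma_measure_ident[OF shape_pos, of i]
  by (simp add: prob_space_M)

text \<open>
  The sum of the gamma variables is independent of their ratios. Rather than proving independence,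
  differentiate at \<open>c = 0\<close> the scaling identity
  \<open>E (exp (- c S) \<Phi>) = (1 + c) powr (- n) * E \<Phi>\<close>.
\<close>

lemma expectation_sum_mult:
  assumes A: "finite A" and \<Phi> [measurable]: "\<Phi> \<in> borel_measurable (Pi\<^sub>M A M)"
    and hom: "\<And>r G. 0 < r \<Longrightarrow> \<Phi> (\<lambda>i\<in>A. G i / r) = \<Phi> G"
    and bdd: "AE G in Pi\<^sub>M A M. \<bar>\<Phi> G\<bar> \<le> (1 :: real)"
  shows "integrable (Pi\<^sub>M A M) (\<lambda>G. (\<Sum>i\<in>A. G i) * \<Phi> G)"
    and "(\<integral>G. (\<Sum>i\<in>A. G i) * \<Phi> G \<partial>Pi\<^sub>M A M) = (\<Sum>i\<in>A. a i) * (\<integral>G. \<Phi> G \<partial>Pi\<^sub>M A M)"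
proof -
  interpret P: prob_space "Pi\<^sub>M A M" by (rule prob_space_product)
  let ?P = "Pi\<^sub>M A M" and ?S = "\<lambda>G. \<Sum>i\<in>A. G i" and ?n = "\<Sum>i\<in>A. a i"
  have S_int: "integrable ?P ?S" by (intro Bochner_Integration.integrable_sum integrable_component)
  have S_nonneg: "AE G in ?P. 0 \<le> ?S G"
    using AE_pos[OF A] by eventually_elim (intro sum_nonneg, simp add: less_imp_le)
  show int: "integrable ?P (\<lambda>G. ?S G * \<Phi> G)"
  proof (rule Bochner_Integration.integrable_bound[OF S_int])
    show "AE G in ?P. norm (?S G * \<Phi> G) \<le> norm (?S G)"
      using bdd by eventually_elim (simp add: abs_mult mult_left_le)
  qed measurable
  have \<Phi>_int: "integrable ?P \<Phi>"
    by (rule P.integrable_const_bound[where B=1]) (use bdd in auto)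
  define c where "c k = 1 / real (Suc k)" for k
  have c: "0 < c k" for k by (simp add: c_def)
  have eq: "(\<integral>G. (1 - exp (- (c k * ?S G))) / c k * \<Phi> G \<partial>?P) = (1 - (1 + c k) powr - ?n) / c k * (\<integral>G. \<Phi> G \<partial>?P)" for k
  proof -
    let ?w = "\<lambda>G. (1 + c k) powr ?n * exp (- (c k * ?S G))"
    \<comment> \<open>By \<open>hom\<close>, \<open>\<Phi>\<close> does not see the rescaling, so
      tilting by \<open>?w\<close> leaves its expectation unchanged.\<close>
    have "integrable (density ?P ?w) \<Phi>"
      using \<Phi>_int c[of k] by (simp add: measure_scale A integrable_distr_eq hom)
    hence w_int: "integrable ?P (\<lambda>G. ?w G * \<Phi> G)"
      by (simp add: integrable_real_density)
    have "(\<integral>G. ?w G * \<Phi> G \<partial>?P) = (\<integral>G. \<Phi> G \<partial>density ?P ?w)"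
      by (simp add: integral_real_density)
    also have "\<dots> = (\<integral>G. \<Phi> G \<partial>?P)"
      using c[of k] by (simp add: measure_scale A integral_distr hom)
    finally have w_eq: "(\<integral>G. ?w G * \<Phi> G \<partial>?P) = (\<integral>G. \<Phi> G \<partial>?P)" .
    \<comment> \<open>Dividing the tilt by its constant exposes the quotient
      \<open>(1 - exp (- (c * s))) / c\<close>, which for \<open>s \<ge> 0\<close> lies between 0
      and \<open>s\<close>, its limit; the sum itself thus dominates.\<close>
    have "(1 - exp (- (c k * s))) / c k * x = x / c k - (1 + c k) powr - ?n / c k * ((1 + c k) powr ?n * exp (- (c k * s)) * x)" for s x
      using c[of k] by (simp add: powr_minus field_simps)
    hence "(\<integral>G. (1 - exp (- (c k * ?S G))) / c k * \<Phi> G \<partial>?P)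
        = (\<integral>G. \<Phi> G / c k - (1 + c k) powr - ?n / c k * (?w G * \<Phi> G) \<partial>?P)"
      by (simp only:)
    also have "\<dots> = (\<integral>G. \<Phi> G \<partial>?P) / c k - (1 + c k) powr - ?n / c k * (\<integral>G. ?w G * \<Phi> G \<partial>?P)"
      using \<Phi>_int w_int
      by (subst Bochner_Integration.integral_diff) (auto simp only: integral_divide_zero integral_mult_right_zero intro!: integrable_divide_zero integrable_mult_right)
    finally show ?thesis unfolding w_eq by (simp add: algebra_simps diff_divide_distrib)
  qed
  have "(\<lambda>k. \<integral>G. (1 - exp (- (c k * ?S G))) / c k * \<Phi> G \<partial>?P) \<longlonglongrightarrow> (\<integral>G. ?S G * \<Phi> G \<partial>?P)"
  proof (rule integral_dominated_convergence[OF _ _ S_int])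
    show "AE G in ?P. (\<lambda>k. (1 - exp (- (c k * ?S G))) / c k * \<Phi> G) \<longlonglongrightarrow> ?S G * \<Phi> G"
    proof (intro AE_I2 tendsto_mult tendsto_const)
      fix G :: "'i \<Rightarrow> real"
      have "((\<lambda>h. 1 - exp (- (h * ?S G))) has_real_derivative ?S G) (at 0)"
        by (auto intro!: derivative_eq_intros)
      from tendsto_difference_quotient_seq[OF this]
      show "(\<lambda>k. (1 - exp (- (c k * ?S G))) / c k) \<longlonglongrightarrow> ?S G"
        unfolding c_def by simp
    qed
    show "AE G in ?P. norm ((1 - exp (- (c k * ?S G))) / c k * \<Phi> G) \<le> ?S G" for k
      using bdd S_nonneg
    proof eventually_elim
      case (elim G)
      have "1 - exp (- (c k * ?S G)) \<le> c k * ?S G" using exp_ge_add_one_self[of "- (c k * ?S G)"] by simp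
      hence "(1 - exp (- (c k * ?S G))) / c k \<le> ?S G" using c[of k] by (simp add: field_simps)
      moreover have "0 \<le> (1 - exp (- (c k * ?S G))) / c k" using c[of k] elim by simp
      ultimately have "\<bar>(1 - exp (- (c k * ?S G))) / c k\<bar> * \<bar>\<Phi> G\<bar> \<le> ?S G * 1"
        using elim by (intro mult_mono) auto
      thus ?case by (simp add: abs_mult)
    qed
  qed measurable
  moreover have "(\<lambda>k. (1 - (1 + c k) powr - ?n) / c k * (\<integral>G. \<Phi> G \<partial>?P)) \<longlonglongrightarrow> ?n * (\<integral>G. \<Phi> G \<partial>?P)"
  proof (intro tendsto_mult tendsto_const)
    have "((\<lambda>h. 1 - (1 + h) powr - ?n) has_real_derivative ?n) (at 0)"
      by (auto intro!: derivative_eq_intros)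
    from tendsto_difference_quotient_seq[OF this]
    show "(\<lambda>k. (1 - (1 + c k) powr - ?n) / c k) \<longlonglongrightarrow> ?n"
      unfolding c_def by simp
  qed
  ultimately show "(\<integral>G. ?S G * \<Phi> G \<partial>?P) = ?n * (\<integral>G. \<Phi> G \<partial>?P)"
    unfolding eq by (rule LIMSEQ_unique)
qed

end

subsection \<open>The homogeneous extension of the Bayes risk\<close>

text \<open>The inequality at both ends of a chord places its slope between the two values of
  \<open>s\<close>. Hence any selection \<open>s\<close> of supergradients is antitone, and a
  monotone function has only countably many discontinuities.\<close>

lemma
  fixes g s :: "real \<Rightarrow> real"
  assumes super: "\<And>t t'. 0 < t \<Longrightarrow> 0 \<le> t' \<Longrightarrow> g t' \<le> g t + (t' - t) * s t"
  shows supergradient_countable_discont: "countable {t. 0 < t \<and> \<not> isCont s t}"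
    and concave_left_quotient_bounds: "\<And>t t'. 0 < t' \<Longrightarrow> t' < t \<Longrightarrow>
      s t \<le> (g t - g t') / (t - t') \<and> (g t - g t') / (t - t') \<le> s t'"
proof -
  show bounds: "s t \<le> (g t - g t') / (t - t') \<and> (g t - g t') / (t - t') \<le> s t'"
    if "0 < t'" "t' < t" for t t'
    using super[of t t'] super[of t' t] that by (simp add: field_simps)
  have "mono_on {0<..} (\<lambda>t. - s t)"
  proof (rule mono_onI)
    fix t t' :: real assume "t \<in> {0<..}" "t' \<in> {0<..}" "t \<le> t'"
    thus "- s t \<le> - s t'" using bounds[of t t'] by (cases "t = t'") auto
  qed
  hence "countable {t \<in> {0<..}. \<not> isCont (\<lambda>t. - s t) t}"
    by (intro mono_on_ctble_discont_open) auto
  moreover have "isCont (\<lambda>t. - s t) t \<longleftrightarrow> isCont s t" for t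
    using isCont_minus[of t s] isCont_minus[of t "\<lambda>t. - s t"] by auto
  ultimately show "countable {t. 0 < t \<and> \<not> isCont s t}" by simp
qed

section \<open>Normalisation on the orthant and the extended risk\<close>

abbreviation (input) orthant :: "(real ^ 'k) set" where
  "orthant \<equiv> {x. \<forall>i. 0 \<le> x $ i}"

abbreviation (input) total :: "real ^ 'k \<Rightarrow> real" where
  "total x \<equiv> \<Sum>i\<in>UNIV. x $ i"

definition nrm :: "real ^ 'k \<Rightarrow> real ^ 'k" where
  "nrm x = x /\<^sub>R total x"

lemma borel_measurable_vec_nth [measurable]: "(\<lambda>x :: real ^ 'k. x $ i) \<in> borel_measurable borel"
  by (intro borel_measurable_continuous_onI continuous_intros)

lemma borel_measurable_nrm [measurable]: "nrm \<in> borel_measurable borel"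
  unfolding nrm_def by measurable

lemma sets_prob_simplex [measurable]: "(prob_simplex :: (real ^ 'k) set) \<in> sets borel"
  unfolding prob_simplex_def by measurable

lemma total_nonneg: "x \<in> orthant \<Longrightarrow> 0 \<le> total x"
  by (simp add: sum_nonneg)

lemma total_eq_0_iff: "x \<in> orthant \<Longrightarrow> total x = 0 \<longleftrightarrow> x = 0"
  by (simp add: sum_nonneg_eq_0_iff vec_eq_iff)

lemma total_pos: "x \<in> orthant \<Longrightarrow> 0 < x $ i \<Longrightarrow> 0 < total x"
  using total_nonneg[of x] total_eq_0_iff[of x] by (auto simp: less_le)

lemma nrm_in_prob_simplex: "x \<in> orthant \<Longrightarrow> 0 < total x \<Longrightarrow> nrm x \<in> prob_simplex"
  by (simp add: nrm_def prob_simplex_def sum_nonneg flip: sum_distrib_left)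

lemma nrm_scale: "0 < r \<Longrightarrow> nrm (r *\<^sub>R x) = nrm x"
  by (simp add: nrm_def vec_eq_iff field_simps flip: sum_distrib_left)

lemma nrm_prob_simplex: "p \<in> prob_simplex \<Longrightarrow> nrm p = p"
  by (simp add: nrm_def prob_simplex_def)

lemma expected_loss_scale: "expected_loss l (r *\<^sub>R p) q = r * expected_loss l p q"
  by (simp add: expected_loss_def sum_distrib_left mult_ac)

definition pos_part :: "real ^ 'k \<Rightarrow> real ^ 'k" where
  "pos_part x = (\<chi> i. max 0 (x $ i))"

lemma pos_part_in_orthant: "pos_part x \<in> orthant"
  by (simp add: pos_part_def)

lemma pos_part_id: "x \<in> orthant \<Longrightarrow> pos_part x = x"
  by (simp add: pos_part_def vec_eq_iff max_def)

text \<open>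
  On the orthant this is the concave 1-homogeneous extension \<open>x \<mapsto> |x| f (x / |x|)\<close> of the Bayes risk
  \<open>f\<close>; truncating at 0 makes it continuous on the whole space, and hence Borel.
\<close>

definition ext_risk :: "(real ^ 'k \<Rightarrow> real ^ 'k \<Rightarrow> real) \<Rightarrow> real ^ 'k \<Rightarrow> real" where
  "ext_risk l x = expected_loss l (pos_part x) (nrm (pos_part x))"

lemma ext_risk_0 [simp]: "ext_risk l 0 = 0"
  by (simp add: ext_risk_def expected_loss_def pos_part_def)

lemma ext_risk_scale: "0 < r \<Longrightarrow> ext_risk l (r *\<^sub>R x) = r * ext_risk l x"
proof -
  assume r: "0 < r"
  hence "pos_part (r *\<^sub>R x) = r *\<^sub>R pos_part x"
    by (simp add: pos_part_def vec_eq_iff max_mult_distrib_left)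
  thus ?thesis using r by (simp add: ext_risk_def nrm_scale expected_loss_scale)
qed

lemma ext_risk_eq_bayes_risk: "p \<in> prob_simplex \<Longrightarrow> ext_risk l p = bayes_risk l p"
  by (simp add: ext_risk_def bayes_risk_def nrm_prob_simplex pos_part_id prob_simplex_def)

lemma ext_risk_nrm: "x \<in> orthant \<Longrightarrow> ext_risk l x = total x * ext_risk l (nrm x)"
proof (cases "x = 0")
  case False
  assume x: "x \<in> orthant"
  hence "0 < total x" using False total_nonneg[OF x] total_eq_0_iff[OF x] by (simp add: less_le)
  moreover from this have "ext_risk l x = ext_risk l (total x *\<^sub>R nrm x)"
    by (simp add: nrm_def)
  ultimately show ?thesis by (simp only: ext_risk_scale)
qed simp

section \<open>Concavity and Lipschitz continuity from properness\<close>

locale bounded_proper_loss =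
  fixes l :: "real ^ 'k \<Rightarrow> real ^ 'k \<Rightarrow> real"
  assumes bounded: "bounded_loss l" and proper: "proper_loss l"
begin

lemma abs_loss_le: "p \<in> prob_simplex \<Longrightarrow> \<bar>l p (axis i 1)\<bar> \<le> 1"
  using bounded by (auto simp: bounded_loss_def abs_le_iff minus_le_iff)

text \<open>Properness compares the report \<open>nrm x\<close> with the truthful report
  \<open>nrm y\<close>; multiplying by \<open>total y\<close> gives a majorant linear in
  \<open>y\<close>. It is attained at \<open>y = x\<close>, so the losses at \<open>nrm x\<close>
  form a supergradient there.\<close>

lemma ext_risk_le:
  assumes "x \<in> orthant" "y \<in> orthant" "0 < total x"
  shows "ext_risk l y \<le> expected_loss l y (nrm x)"
proof (cases "y = 0")
  case False
  hence pos: "0 < total y"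
    using total_nonneg[OF assms(2)] total_eq_0_iff[OF assms(2)] by (simp add: less_le)
  have "expected_loss l (nrm y) (nrm y) \<le> expected_loss l (nrm y) (nrm x)"
    using proper assms pos by (simp add: proper_loss_def nrm_in_prob_simplex)
  hence "total y * expected_loss l (nrm y) (nrm y) \<le> total y * expected_loss l (nrm y) (nrm x)"
    using pos by (intro mult_left_mono) auto
  moreover have "total y *\<^sub>R nrm y = y" using pos by (simp add: nrm_def)
  ultimately show ?thesis
    using assms by (simp add: ext_risk_def pos_part_id flip: expected_loss_scale)
qed (simp add: expected_loss_def)

lemma ext_risk_supergradient:
  assumes "x \<in> orthant" "y \<in> orthant" "0 < total x"
  shows "ext_risk l y \<le> ext_risk l x + (\<Sum>i\<in>UNIV. (y $ i - x $ i) * l (nrm x) (axis i 1))"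
  using ext_risk_le[OF assms] assms(1)
  by (simp add: ext_risk_def[of l x] pos_part_id expected_loss_def sum_subtractf left_diff_distrib)

text \<open>Supergradients with entries in [-1, 1] bound increments from above, and exchanging the
  points gives the other side. Truncation \<open>pos_part\<close> does not increase coordinate
  distances, which carries the bound to the whole space.\<close>

lemma ext_risk_lipschitz: "\<bar>ext_risk l y - ext_risk l x\<bar> \<le> (\<Sum>i\<in>UNIV. \<bar>y $ i - x $ i\<bar>)"
proof -
  have le: "ext_risk l y - ext_risk l x \<le> (\<Sum>i\<in>UNIV. \<bar>y $ i - x $ i\<bar>)"
    if "x \<in> orthant" "y \<in> orthant" for x y
  proof (cases "x = 0 \<and> y = 0")
    case False
    \<comment> \<open>A supergradient requires a base point of positive total. If
      \<open>x = 0\<close>, the linear majorant based at \<open>y\<close> is used instead; it agrees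
      with the risk at 0.\<close>
    define z where "z = (if x = 0 then y else x)"
    have z: "z \<in> orthant" "z \<noteq> 0" using False that by (auto simp: z_def)
    hence pos: "0 < total z" using total_nonneg[of z] total_eq_0_iff[of z] by (simp add: less_le)
    have "ext_risk l y - ext_risk l x \<le> (\<Sum>i\<in>UNIV. (y $ i - x $ i) * l (nrm z) (axis i 1))"
    proof (cases "x = 0")
      case True
      thus ?thesis using ext_risk_le[OF z(1) that(2) pos] by (simp add: expected_loss_def)
    next
      case False
      thus ?thesis using ext_risk_supergradient[OF that] pos by (simp add: z_def)
    qed
    also have "\<dots> \<le> (\<Sum>i\<in>UNIV. \<bar>y $ i - x $ i\<bar>)"
    proof (rule sum_mono)
      fix i
      have "\<bar>(y $ i - x $ i) * l (nrm z) (axis i 1)\<bar> \<le> \<bar>y $ i - x $ i\<bar> * 1"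
        unfolding abs_mult using abs_loss_le[OF nrm_in_prob_simplex[OF z(1) pos]]
        by (intro mult_left_mono) auto
      thus "(y $ i - x $ i) * l (nrm z) (axis i 1) \<le> \<bar>y $ i - x $ i\<bar>"
        using abs_ge_self[of "(y $ i - x $ i) * l (nrm z) (axis i 1)"] by (simp only: mult_1_right)
    qed
    finally show ?thesis .
  qed simp
  have sym: "(\<Sum>i\<in>UNIV. \<bar>pos_part x $ i - pos_part y $ i\<bar>) = (\<Sum>i\<in>UNIV. \<bar>pos_part y $ i - pos_part x $ i\<bar>)"
    by (simp add: abs_minus_commute)
  have ext: "ext_risk l (pos_part z) = ext_risk l z" for z
    by (simp add: ext_risk_def pos_part_id pos_part_in_orthant[simplified])
  have "\<bar>ext_risk l y - ext_risk l x\<bar> \<le> (\<Sum>i\<in>UNIV. \<bar>pos_part y $ i - pos_part x $ i\<bar>)"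
    using le[of "pos_part x" "pos_part y"] le[of "pos_part y" "pos_part x"]
    unfolding sym ext by (auto simp: pos_part_in_orthant[simplified] abs_le_iff)
  also have "\<dots> \<le> (\<Sum>i\<in>UNIV. \<bar>y $ i - x $ i\<bar>)"
    by (intro sum_mono) (auto simp: pos_part_def)
  finally show ?thesis .
qed

lemma abs_ext_risk_le: "x \<in> orthant \<Longrightarrow> \<bar>ext_risk l x\<bar> \<le> total x"
  using ext_risk_lipschitz[of x 0] by simp

lemma borel_measurable_ext_risk [measurable]: "ext_risk l \<in> borel_measurable borel"
proof (rule borel_measurable_continuous_onI)
  have "CARD('k)-lipschitz_on UNIV (ext_risk l)"
  proof (rule lipschitz_onI)
    fix x y :: "real ^ 'k"
    have "\<bar>ext_risk l x - ext_risk l y\<bar> \<le> (\<Sum>i\<in>UNIV. \<bar>(x - y) $ i\<bar>)"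
      using ext_risk_lipschitz[of x y] by simp
    also have "\<dots> \<le> (\<Sum>i\<in>(UNIV :: 'k set). norm (x - y))"
      by (intro sum_mono component_le_norm_cart)
    finally show "dist (ext_risk l x) (ext_risk l y) \<le> CARD('k) * dist x y"
      by (simp add: dist_norm)
  qed simp
  thus "continuous_on UNIV (ext_risk l)" by (rule lipschitz_on_continuous_on)
qed

section \<open>Difference quotients along a coordinate\<close>

text \<open>
  Difference quotients along coordinate \<open>j\<close> whose step is proportional to \<open>x $ j\<close>, so that they are
  invariant under scaling of \<open>x\<close>.
\<close>

definition left_quotient :: "'k \<Rightarrow> real \<Rightarrow> real ^ 'k \<Rightarrow> real" where
  "left_quotient j c x =
    (ext_risk l x - ext_risk l (x - (x $ j - x $ j / (1 + c)) *\<^sub>R axis j 1)) / (x $ j - x $ j / (1 + c))"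

definition right_quotient :: "'k \<Rightarrow> real \<Rightarrow> real ^ 'k \<Rightarrow> real" where
  "right_quotient j c x =
    (ext_risk l (x + (x $ j * (1 + c) - x $ j) *\<^sub>R axis j 1) - ext_risk l x) / (x $ j * (1 + c) - x $ j)"

lemma borel_measurable_quotients [measurable]:
  "left_quotient j c \<in> borel_measurable borel" "right_quotient j c \<in> borel_measurable borel"
  unfolding left_quotient_def right_quotient_def by measurable

lemma quotients_scale:
  assumes "0 < r"
  shows "left_quotient j c (r *\<^sub>R x) = left_quotient j c x"
    and "right_quotient j c (r *\<^sub>R x) = right_quotient j c x"
proof -
  have "r *\<^sub>R x - ((r *\<^sub>R x) $ j - (r *\<^sub>R x) $ j / (1 + c)) *\<^sub>R axis j 1
      = r *\<^sub>R (x - (x $ j - x $ j / (1 + c)) *\<^sub>R axis j 1)"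
    "r *\<^sub>R x + ((r *\<^sub>R x) $ j * (1 + c) - (r *\<^sub>R x) $ j) *\<^sub>R axis j 1
      = r *\<^sub>R (x + (x $ j * (1 + c) - x $ j) *\<^sub>R axis j 1)"
    by (simp_all add: algebra_simps)
  moreover have "(r *\<^sub>R x) $ j - (r *\<^sub>R x) $ j / (1 + c) = r * (x $ j - x $ j / (1 + c))"
    "(r *\<^sub>R x) $ j * (1 + c) - (r *\<^sub>R x) $ j = r * (x $ j * (1 + c) - x $ j)"
    by (simp_all add: algebra_simps)
  ultimately show "left_quotient j c (r *\<^sub>R x) = left_quotient j c x"
    "right_quotient j c (r *\<^sub>R x) = right_quotient j c x"
    unfolding left_quotient_def right_quotient_def using assms
    by (simp_all only: ext_risk_scale mult_divide_mult_cancel_left right_diff_distrib[symmetric] less_irrefl)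
qed

context
  fixes y :: "real ^ 'k" and j :: 'k
  assumes y: "y \<in> orthant" "y $ j = 0"
begin

lemma axis_line:
  assumes "0 \<le> t"
  shows "y + t *\<^sub>R axis j 1 \<in> orthant" "(y + t *\<^sub>R axis j 1) $ j = t"
    "0 < t \<Longrightarrow> 0 < total (y + t *\<^sub>R axis j 1)"
proof -
  show 1: "y + t *\<^sub>R axis j 1 \<in> orthant" using y assms by (auto simp: axis_def)
  show 2: "(y + t *\<^sub>R axis j 1) $ j = t" using y by simp
  show "0 < total (y + t *\<^sub>R axis j 1)" if "0 < t"
    using total_pos[OF 1, of j] 2 that by simp
qed

lemma line_supergradient:
  assumes "0 < t" "0 \<le> t'"
  shows "ext_risk l (y + t' *\<^sub>R axis j 1)
    \<le> ext_risk l (y + t *\<^sub>R axis j 1) + (t' - t) * l (nrm (y + t *\<^sub>R axis j 1)) (axis j 1)"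
proof -
  have "(\<Sum>i\<in>UNIV. ((y + t' *\<^sub>R axis j 1) $ i - (y + t *\<^sub>R axis j 1) $ i) * l (nrm (y + t *\<^sub>R axis j 1)) (axis i 1))
      = (\<Sum>i\<in>UNIV. if i = j then (t' - t) * l (nrm (y + t *\<^sub>R axis j 1)) (axis i 1) else 0)"
    by (intro sum.cong) (auto simp: axis_def)
  also have "\<dots> = (t' - t) * l (nrm (y + t *\<^sub>R axis j 1)) (axis j 1)" by simp
  finally show ?thesis
    using ext_risk_supergradient[OF axis_line(1)[of t] axis_line(1)[of t'] axis_line(3)[of t]] assms
    by simp
qed

lemma left_quotient_line:
  "0 < t \<Longrightarrow> left_quotient j c (y + t *\<^sub>R axis j 1) =
    (ext_risk l (y + t *\<^sub>R axis j 1) - ext_risk l (y + (t / (1 + c)) *\<^sub>R axis j 1)) / (t - t / (1 + c))"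
  using y by (simp add: left_quotient_def algebra_simps)

lemma right_quotient_line:
  "0 < t \<Longrightarrow> right_quotient j c (y + t *\<^sub>R axis j 1) =
    (ext_risk l (y + (t * (1 + c)) *\<^sub>R axis j 1) - ext_risk l (y + t *\<^sub>R axis j 1)) / (t * (1 + c) - t)"
  using y by (simp add: right_quotient_def algebra_simps)

text \<open>The quotients are chord slopes on the intervals from \<open>t / (1 + c)\<close> to
  \<open>t\<close> and from \<open>t\<close> to \<open>t * (1 + c)\<close>. Together the bounds form
  a chain in which \<open>s t\<close> lies between two Borel functions.\<close>

lemma quotients_line_bounds:
  fixes t c :: real
  defines "s \<equiv> \<lambda>t. l (nrm (y + t *\<^sub>R axis j 1)) (axis j 1)"
  assumes t: "0 < t" and c: "0 < c"
  shows "s t \<le> left_quotient j c (y + t *\<^sub>R axis j 1)" "left_quotient j c (y + t *\<^sub>R axis j 1) \<le> s (t / (1 + c))"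
    "s (t * (1 + c)) \<le> right_quotient j c (y + t *\<^sub>R axis j 1)" "right_quotient j c (y + t *\<^sub>R axis j 1) \<le> s t"
proof -
  have 1: "0 < t / (1 + c)" "t / (1 + c) < t" "t < t * (1 + c)" using t c by (auto simp: field_simps)
  have "ext_risk l (y + t' *\<^sub>R axis j 1) \<le> ext_risk l (y + t *\<^sub>R axis j 1) + (t' - t) * s t"
    if "0 < t" "0 \<le> t'" for t t'
    unfolding s_def using that by (rule line_supergradient)
  note bounds = concave_left_quotient_bounds[of "\<lambda>t. ext_risk l (y + t *\<^sub>R axis j 1)" s, OF this]
  show "s t \<le> left_quotient j c (y + t *\<^sub>R axis j 1)" "left_quotient j c (y + t *\<^sub>R axis j 1) \<le> s (t / (1 + c))"
    using bounds[OF _ _ 1(1,2)] left_quotient_line[OF t] by (simp_all add: s_def)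
  show "s (t * (1 + c)) \<le> right_quotient j c (y + t *\<^sub>R axis j 1)" "right_quotient j c (y + t *\<^sub>R axis j 1) \<le> s t"
    using bounds[OF _ _ t 1(3)] right_quotient_line[OF t] by (simp_all add: s_def)
qed

text \<open>Where the loss is continuous along the line, the outer ends of the chain of bounds have
  the same limit. The remaining points are countable, and the gamma law has no atoms.\<close>

lemma AE_quotients_line:
  "AE t in gamma_measure a. (\<lambda>k. left_quotient j (1 / real (Suc k)) (y + t *\<^sub>R axis j 1)
    - right_quotient j (1 / real (Suc k)) (y + t *\<^sub>R axis j 1)) \<longlonglongrightarrow> 0"
proof -
  let ?s = "\<lambda>t. l (nrm (y + t *\<^sub>R axis j 1)) (axis j 1)"
  have "countable {t. 0 < t \<and> \<not> isCont ?s t}"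
    using line_supergradient by (rule supergradient_countable_discont)
  from AE_gamma_measure_countable[OF this, of a] AE_gamma_measure_pos[of a] show ?thesis
  proof eventually_elim
    case (elim t)
    hence cont: "isCont ?s t" and t: "0 < t" by auto
    define c where "c k = 1 / real (Suc k)" for k
    have c: "0 < c k" for k by (simp add: c_def)
    have "c \<longlonglongrightarrow> 0" unfolding c_def using LIMSEQ_inverse_real_of_nat by (simp add: divide_inverse)
    hence "(\<lambda>k. t / (1 + c k)) \<longlonglongrightarrow> t / (1 + 0)" "(\<lambda>k. t * (1 + c k)) \<longlonglongrightarrow> t * (1 + 0)"
      by (intro tendsto_intros; simp)+
    hence "(\<lambda>k. ?s (t / (1 + c k)) - ?s (t * (1 + c k))) \<longlonglongrightarrow> ?s t - ?s t"
      using cont by (intro tendsto_diff isCont_tendsto_compose[of t ?s]) auto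
    hence lim: "(\<lambda>k. ?s (t / (1 + c k)) - ?s (t * (1 + c k))) \<longlonglongrightarrow> 0" by simp
    have "(\<lambda>k. left_quotient j (c k) (y + t *\<^sub>R axis j 1) - right_quotient j (c k) (y + t *\<^sub>R axis j 1)) \<longlonglongrightarrow> 0"
    proof (rule tendsto_sandwich[OF _ _ tendsto_const lim])
      show "\<forall>\<^sub>F k in sequentially. 0 \<le> left_quotient j (c k) (y + t *\<^sub>R axis j 1) - right_quotient j (c k) (y + t *\<^sub>R axis j 1)"
        using quotients_line_bounds(1,4)[OF t c] by (intro always_eventually allI) (auto intro: order_trans)
      show "\<forall>\<^sub>F k in sequentially. left_quotient j (c k) (y + t *\<^sub>R axis j 1) - right_quotient j (c k) (y + t *\<^sub>R axis j 1)
          \<le> ?s (t / (1 + c k)) - ?s (t * (1 + c k))"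
        using quotients_line_bounds(2,3)[OF t c] by (intro always_eventually allI diff_mono) auto
    qed
    thus ?case by (simp add: c_def)
  qed
qed

end

text \<open>A pointwise criterion: once the Borel condition has been carried to almost every point
  by Fubini and scaling, it identifies the limit with the actual loss at that point.\<close>

lemma left_quotient_tendsto:
  assumes x: "x \<in> orthant" "0 < x $ j"
    and lim: "(\<lambda>k. left_quotient j (1 / real (Suc k)) x - right_quotient j (1 / real (Suc k)) x) \<longlonglongrightarrow> 0"
  shows "(\<lambda>k. left_quotient j (1 / real (Suc k)) x) \<longlonglongrightarrow> l (nrm x) (axis j 1)"
proof -
  define y where "y = x - (x $ j) *\<^sub>R axis j 1"
  have y: "y \<in> orthant" "y $ j = 0" using x by (auto simp: y_def axis_def)
  have xy: "y + (x $ j) *\<^sub>R axis j 1 = x" by (simp add: y_def)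
  note b = quotients_line_bounds[OF y x(2), unfolded xy]
  have "(\<lambda>k. left_quotient j (1 / real (Suc k)) x - l (nrm x) (axis j 1)) \<longlonglongrightarrow> 0"
  proof (rule tendsto_sandwich[OF _ _ tendsto_const lim])
    show "\<forall>\<^sub>F k in sequentially. 0 \<le> left_quotient j (1 / real (Suc k)) x - l (nrm x) (axis j 1)"
      using b(1) by (intro always_eventually allI) auto
    show "\<forall>\<^sub>F k in sequentially. left_quotient j (1 / real (Suc k)) x - l (nrm x) (axis j 1)
        \<le> left_quotient j (1 / real (Suc k)) x - right_quotient j (1 / real (Suc k)) x"
      using b(4) by (intro always_eventually allI diff_mono) auto
  qed
  thus ?thesis by (simp add: LIM_zero_iff)
qed

text \<open>Borel stand-in for \<open>l (nrm x) (axis j 1)\<close>. Where the quotients diverge,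
  \<open>lim\<close> returns an unspecified value; this happens only on a null set of the laws
  considered.\<close>

definition left_deriv :: "'k \<Rightarrow> real ^ 'k \<Rightarrow> real" where
  "left_deriv j x = lim (\<lambda>k. left_quotient j (1 / real (Suc k)) x)"

lemma borel_measurable_left_deriv [measurable]: "left_deriv j \<in> borel_measurable borel"
  unfolding left_deriv_def by measurable

lemma left_deriv_scale: "0 < r \<Longrightarrow> left_deriv j (r *\<^sub>R x) = left_deriv j x"
  by (simp add: left_deriv_def quotients_scale)

end

subsection \<open>Integration against Dirichlet laws\<close>

text \<open>Measurability of \<open>g\<close> is a conclusion here: the completion contains every
  subset of a null set, so agreement almost everywhere with a Borel function suffices. This is how
  the loss gets an integral.\<close>

lemma
  fixes f g :: "'a \<Rightarrow> real"
  assumes f: "f \<in> borel_measurable M" and ae: "AE x in M. g x = f x"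
  shows integrable_completion_cong_AE: "integrable (completion M) g \<longleftrightarrow> integrable M f"
    and integral_completion_cong_AE: "integral\<^sup>L (completion M) g = integral\<^sup>L M f"
proof -
  have ae': "AE x in completion M. g x = f x" using ae by (rule AE_completion)
  have f': "f \<in> borel_measurable (completion M)" using f by (rule measurable_completion)
  have g': "g \<in> borel_measurable (completion M)"
  proof (rule measurableI)
    fix B :: "real set" assume B: "B \<in> sets borel"
    show "g -` B \<inter> space (completion M) \<in> sets (completion M)"
    proof (rule completion.in_sets_AE)
      show "AE x in completion M. x \<in> f -` B \<inter> space (completion M) \<longleftrightarrow> x \<in> g -` B \<inter> space (completion M)"
        using ae' by eventually_elim auto
      show "f -` B \<inter> space (completion M) \<in> sets (completion M)"
        using f' B by (rule measurable_sets)
    qed auto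
  qed simp
  show "integrable (completion M) g \<longleftrightarrow> integrable M f"
    using integrable_cong_AE[OF g' f' ae'] integrable_completion[OF f] by simp
  show "integral\<^sup>L (completion M) g = integral\<^sup>L M f"
    using integral_cong_AE[OF g' f' ae'] integral_completion[OF f] by simp
qed

definition face_embed :: "'k set \<Rightarrow> ('k \<Rightarrow> real) \<Rightarrow> real ^ 'k" where
  "face_embed A G = (\<Sum>i\<in>A. G i *\<^sub>R axis i 1)"

lemma face_embed_nth: "face_embed A G $ i = (if i \<in> A then G i else 0)"
proof -
  have "face_embed A G $ i = (\<Sum>k\<in>A. if k = i then G k else 0)"
    unfolding face_embed_def sum_component by (intro sum.cong) (auto simp: axis_def)
  thus ?thesis by simp
qed

lemma total_face_embed: "total (face_embed A G) = (\<Sum>i\<in>A. G i)"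
  unfolding face_embed_nth by (simp add: sum.If_cases)

lemma face_embed_insert: "j \<notin> A \<Longrightarrow> face_embed (insert j A) (G(j := t)) = face_embed A G + t *\<^sub>R axis j 1"
  by (auto simp: vec_eq_iff face_embed_nth axis_def)

lemma face_embed_in_orthant: "\<forall>i\<in>A. 0 < G i \<Longrightarrow> face_embed A G \<in> orthant"
  by (auto simp: face_embed_nth)

lemma face_embed_restrict_scale: "0 < r \<Longrightarrow> face_embed A (\<lambda>i\<in>A. G i / r) = (1 / r) *\<^sub>R face_embed A G"
  by (simp add: vec_eq_iff face_embed_nth)

text \<open>The shapes \<open>a\<close> are tied to \<open>\<alpha>\<close> on its support only,
  which leaves room to pad the zero entries with positive values.\<close>

lemma dirichlet_eq_distr:
  fixes \<alpha> :: "real ^ 'k"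
  assumes "\<And>i. 0 < \<alpha> $ i \<Longrightarrow> a i = \<alpha> $ i"
  shows "dirichlet \<alpha> = distr (\<Pi>\<^sub>M i\<in>{i. 0 < \<alpha> $ i}. gamma_measure (a i)) borel
    (\<lambda>G. nrm (face_embed {i. 0 < \<alpha> $ i} G))"
proof -
  have "(\<chi> i. if i \<in> A then G i / (\<Sum>k\<in>A. G k) else 0) = nrm (face_embed A G)" for A and G :: "'k \<Rightarrow> real"
    unfolding nrm_def total_face_embed by (simp add: vec_eq_iff face_embed_nth divide_inverse mult_ac)
  moreover have "(\<Pi>\<^sub>M i\<in>{i. 0 < \<alpha> $ i}. gamma_measure (\<alpha> $ i)) = (\<Pi>\<^sub>M i\<in>{i. 0 < \<alpha> $ i}. gamma_measure (a i))"
    using assms by (intro PiM_cong) auto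
  ultimately show ?thesis unfolding dirichlet_def Let_def by (simp only:)
qed

section \<open>Transfer between gamma products and Dirichlet laws\<close>

locale dirichlet_loss = gamma_product a + bounded_proper_loss l
  for a :: "'k::finite \<Rightarrow> real" and l :: "real ^ 'k \<Rightarrow> real ^ 'k \<Rightarrow> real"
begin

abbreviation dir :: "'k set \<Rightarrow> (real ^ 'k) measure" where
  "dir A \<equiv> distr (Pi\<^sub>M A M) borel (\<lambda>G. nrm (face_embed A G))"

lemma borel_measurable_face_embed [measurable]: "face_embed A \<in> Pi\<^sub>M A M \<rightarrow>\<^sub>M borel"
  unfolding face_embed_def by measurable

text \<open>By homogeneity the integrand is the sum of the gamma variables times a bounded function
  of their ratios, so \<open>expectation_sum_mult\<close> applies. For empty \<open>A\<close>
  everything is 0, which later covers \<open>n = 1\<close>.\<close>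

lemma integral_ext_risk_dir:
  "integrable (Pi\<^sub>M A M) (\<lambda>G. ext_risk l (face_embed A G))"
  "(\<integral>G. ext_risk l (face_embed A G) \<partial>Pi\<^sub>M A M) = (\<Sum>i\<in>A. a i) * (\<integral>p. ext_risk l p \<partial>dir A)"
proof -
  let ?\<Phi> = "\<lambda>G. ext_risk l (nrm (face_embed A G))"
  have bdd: "AE G in Pi\<^sub>M A M. \<bar>?\<Phi> G\<bar> \<le> 1"
    using AE_pos[of A, OF finite]
  proof eventually_elim
    case (elim G)
    note orth = face_embed_in_orthant[OF elim]
    show ?case
    proof (cases "face_embed A G = 0")
      case False
      hence "0 < total (face_embed A G)"
        using total_nonneg[OF orth] total_eq_0_iff[OF orth] by (simp add: less_le)
      from nrm_in_prob_simplex[OF orth this] show ?thesis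
        using abs_ext_risk_le[of "nrm (face_embed A G)"] by (simp add: prob_simplex_def)
    qed (simp add: nrm_def)
  qed
  have hom: "?\<Phi> (\<lambda>i\<in>A. G i / r) = ?\<Phi> G" if "0 < r" for r G
    using that by (simp add: face_embed_restrict_scale nrm_scale)
  have eq: "AE G in Pi\<^sub>M A M. (\<Sum>i\<in>A. G i) * ?\<Phi> G = ext_risk l (face_embed A G)"
    using AE_pos[of A, OF finite]
  proof eventually_elim
    case (elim G)
    thus ?case using ext_risk_nrm[OF face_embed_in_orthant, of A G l] by (simp add: total_face_embed)
  qed
  note E = expectation_sum_mult[of A ?\<Phi>, OF finite _ hom bdd]
  have meas: "?\<Phi> \<in> borel_measurable (Pi\<^sub>M A M)" by measurable
  show "integrable (Pi\<^sub>M A M) (\<lambda>G. ext_risk l (face_embed A G))"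
    by (rule integrable_cong_AE[THEN iffD1, OF _ _ eq E(1)[OF meas]]) measurable
  have "(\<integral>G. ext_risk l (face_embed A G) \<partial>Pi\<^sub>M A M) = (\<integral>G. (\<Sum>i\<in>A. G i) * ?\<Phi> G \<partial>Pi\<^sub>M A M)"
    by (rule integral_cong_AE[symmetric, OF _ _ eq]) measurable
  also have "\<dots> = (\<Sum>i\<in>A. a i) * (\<integral>G. ?\<Phi> G \<partial>Pi\<^sub>M A M)"
    by (rule E(2)[OF meas])
  also have "(\<integral>G. ?\<Phi> G \<partial>Pi\<^sub>M A M) = (\<integral>p. ext_risk l p \<partial>dir A)"
    by (simp add: integral_distr)
  finally show "(\<integral>G. ext_risk l (face_embed A G) \<partial>Pi\<^sub>M A M) = (\<Sum>i\<in>A. a i) * (\<integral>p. ext_risk l p \<partial>dir A)" .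
qed

lemma AE_dir_simplex:
  assumes "A \<noteq> {}"
  shows "AE p in dir A. p \<in> prob_simplex \<and> (\<forall>i\<in>A. 0 < p $ i)"
proof (subst AE_distr_iff)
  show "AE G in Pi\<^sub>M A M. nrm (face_embed A G) \<in> prob_simplex \<and> (\<forall>i\<in>A. 0 < nrm (face_embed A G) $ i)"
    using AE_pos[of A, OF finite]
  proof eventually_elim
    case (elim G)
    obtain i where i: "i \<in> A" using assms by blast
    have pos: "0 < total (face_embed A G)"
      by (rule total_pos[OF face_embed_in_orthant[OF elim], of i]) (use i elim in \<open>simp add: face_embed_nth\<close>)
    have "0 < nrm (face_embed A G) $ i" if "i \<in> A" for i
      using that pos elim by (simp add: nrm_def face_embed_nth)
    thus ?case using nrm_in_prob_simplex[OF face_embed_in_orthant[OF elim] pos] by blast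
  qed
  show "{p \<in> space borel. p \<in> prob_simplex \<and> (\<forall>i\<in>A. 0 < p $ i)} \<in> sets borel" by measurable
qed measurable

lemma bayes_risk_dir:
  assumes "A \<noteq> {}"
  shows "integrable (completion (dir A)) (bayes_risk l)"
    and "(\<integral>p. bayes_risk l p \<partial>completion (dir A)) = (\<integral>p. ext_risk l p \<partial>dir A)"
proof -
  interpret P: prob_space "dir A" by (intro prob_space.prob_space_distr prob_space_product) measurable
  have ae: "AE p in dir A. bayes_risk l p = ext_risk l p"
    using AE_dir_simplex[OF assms] by eventually_elim (simp add: ext_risk_eq_bayes_risk)
  have "AE p in dir A. norm (ext_risk l p) \<le> 1"
    using AE_dir_simplex[OF assms]
  proof eventually_elim
    case (elim p)
    thus ?case using abs_ext_risk_le[of p] by (simp add: prob_simplex_def)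
  qed
  hence "integrable (dir A) (ext_risk l)"
    by (intro P.integrable_const_bound[where B=1]) auto
  thus "integrable (completion (dir A)) (bayes_risk l)"
    using integrable_completion_cong_AE[OF _ ae] by simp
  show "(\<integral>p. bayes_risk l p \<partial>completion (dir A)) = (\<integral>p. ext_risk l p \<partial>dir A)"
    by (rule integral_completion_cong_AE[OF _ ae]) measurable
qed

lemma AE_quotients_product:
  assumes "j \<notin> J"
  shows "AE G in Pi\<^sub>M (insert j J) M. (\<lambda>k. left_quotient j (1 / real (Suc k)) (face_embed (insert j J) G)
    - right_quotient j (1 / real (Suc k)) (face_embed (insert j J) G)) \<longlonglongrightarrow> 0"
proof (rule AE_insert[OF finite assms])
  show "AE G in Pi\<^sub>M J M. AE t in M j. (\<lambda>k. left_quotient j (1 / real (Suc k)) (face_embed (insert j J) (G(j := t)))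
    - right_quotient j (1 / real (Suc k)) (face_embed (insert j J) (G(j := t)))) \<longlonglongrightarrow> 0"
    using AE_pos[of J, OF finite]
  proof eventually_elim
    case (elim G)
    show ?case unfolding face_embed_insert[OF assms]
      by (rule AE_quotients_line[OF face_embed_in_orthant[OF elim]]) (use assms in \<open>simp add: face_embed_nth\<close>)
  qed
qed measurable

lemma AE_left_deriv_product:
  assumes "j \<notin> J"
  shows "AE G in Pi\<^sub>M (insert j J) M. \<bar>left_deriv j (face_embed (insert j J) G)\<bar> \<le> 1"
  using AE_quotients_product[OF assms] AE_pos[of "insert j J", OF finite]
proof eventually_elim
  case (elim G)
  note orth = face_embed_in_orthant[OF elim(2)]
  have pos: "0 < face_embed (insert j J) G $ j" using elim(2) by (simp add: face_embed_nth)
  from left_quotient_tendsto[OF orth pos elim(1)]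
  have "left_deriv j (face_embed (insert j J) G) = l (nrm (face_embed (insert j J) G)) (axis j 1)"
    unfolding left_deriv_def by (rule limI)
  thus ?case using abs_loss_le[OF nrm_in_prob_simplex[OF orth total_pos[OF orth pos]]] by simp
qed

text \<open>Almost everywhere the loss equals the Borel function \<open>left_deriv\<close>, whose
  scale invariance then removes the normalisation. What remains is an integral over independent
  coordinates, ready for Fubini.\<close>

lemma loss_dir:
  assumes j: "j \<notin> J"
  shows "integrable (completion (dir (insert j J))) (\<lambda>p. l p (axis j 1))"
    and "(\<integral>p. l p (axis j 1) \<partial>completion (dir (insert j J)))
      = (\<integral>G. left_deriv j (face_embed (insert j J) G) \<partial>Pi\<^sub>M (insert j J) M)"
proof -
  let ?A = "insert j J"
  interpret P: prob_space "dir ?A" by (intro prob_space.prob_space_distr prob_space_product) measurable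
  let ?Z = "\<lambda>x. (\<lambda>k. left_quotient j (1 / real (Suc k)) x - right_quotient j (1 / real (Suc k)) x) \<longlonglongrightarrow> 0"
  have Z: "AE p in dir ?A. ?Z p"
  proof (subst AE_distr_iff)
    show "AE G in Pi\<^sub>M ?A M. ?Z (nrm (face_embed ?A G))"
      using AE_quotients_product[OF j] AE_pos[of ?A, OF finite]
    proof eventually_elim
      case (elim G)
      have "0 < total (face_embed ?A G)"
        by (rule total_pos[OF face_embed_in_orthant[OF elim(2)], of j]) (use elim in \<open>simp add: face_embed_nth\<close>)
      thus ?case using elim(1) by (simp add: nrm_def[of "face_embed ?A G"] quotients_scale)
    qed
  qed measurable
  have ae: "AE p in dir ?A. l p (axis j 1) = left_deriv j p"
    using Z AE_dir_simplex[of ?A, OF insert_not_empty]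
  proof eventually_elim
    case (elim p)
    hence "(\<lambda>k. left_quotient j (1 / real (Suc k)) p) \<longlonglongrightarrow> l (nrm p) (axis j 1)"
      by (intro left_quotient_tendsto) (auto simp: prob_simplex_def)
    thus ?case using elim by (simp add: left_deriv_def limI nrm_prob_simplex)
  qed
  have "AE p in dir ?A. norm (left_deriv j p) \<le> 1"
    using ae AE_dir_simplex[of ?A, OF insert_not_empty]
  proof eventually_elim
    case (elim p)
    thus ?case using abs_loss_le[of p j] by simp
  qed
  hence "integrable (dir ?A) (left_deriv j)"
    by (intro P.integrable_const_bound[where B=1]) auto
  thus "integrable (completion (dir ?A)) (\<lambda>p. l p (axis j 1))"
    using integrable_completion_cong_AE[OF _ ae] by simp
  have "(\<integral>p. l p (axis j 1) \<partial>completion (dir ?A)) = (\<integral>p. left_deriv j p \<partial>dir ?A)"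
    by (rule integral_completion_cong_AE[OF _ ae]) measurable
  also have "\<dots> = (\<integral>G. left_deriv j (nrm (face_embed ?A G)) \<partial>Pi\<^sub>M ?A M)"
    by (simp add: integral_distr)
  also have "\<dots> = (\<integral>G. left_deriv j (face_embed ?A G) \<partial>Pi\<^sub>M ?A M)"
  proof (rule integral_cong_AE)
    show "AE G in Pi\<^sub>M ?A M. left_deriv j (nrm (face_embed ?A G)) = left_deriv j (face_embed ?A G)"
      using AE_pos[of ?A, OF finite]
    proof eventually_elim
      case (elim G)
      have "0 < total (face_embed ?A G)"
        by (rule total_pos[OF face_embed_in_orthant[OF elim], of j]) (use elim in \<open>simp add: face_embed_nth\<close>)
      thus ?case by (simp add: nrm_def left_deriv_scale)
    qed
  qed measurable
  finally show "(\<integral>p. l p (axis j 1) \<partial>completion (dir ?A)) = (\<integral>G. left_deriv j (face_embed ?A G) \<partial>Pi\<^sub>M ?A M)" .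
qed

text \<open>The shape \<open>b\<close> is free because it will be \<open>a j - 1\<close>, which is
  foreign to the family \<open>a\<close>. The bound of the risk by the total of the coordinates
  gives an integrable majorant.\<close>

lemma integrable_line_average:
  assumes "0 < b"
  shows "integrable (Pi\<^sub>M J M) (\<lambda>G. \<integral>t. ext_risk l (face_embed J G + t *\<^sub>R axis j 1) \<partial>gamma_measure b)"
proof -
  interpret b: prob_space "gamma_measure b" using assms by (rule prob_space_gamma_measure)
  have line_int: "integrable (gamma_measure b) (\<lambda>t. c + t)" for c
    using integrable_gamma_measure_ident[OF assms] by auto
  show ?thesis
  proof (rule Bochner_Integration.integrable_bound)
    show "integrable (Pi\<^sub>M J M) (\<lambda>G. (\<Sum>i\<in>J. G i) + (\<integral>t. t \<partial>gamma_measure b))"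
    proof -
      interpret P: prob_space "Pi\<^sub>M J M" by (rule prob_space_product)
      show ?thesis by (intro Bochner_Integration.integrable_add Bochner_Integration.integrable_sum integrable_component) auto
    qed
    show "AE G in Pi\<^sub>M J M. norm (\<integral>t. ext_risk l (face_embed J G + t *\<^sub>R axis j 1) \<partial>gamma_measure b)
        \<le> norm ((\<Sum>i\<in>J. G i) + (\<integral>t. t \<partial>gamma_measure b))"
      using AE_pos[of J, OF finite]
    proof eventually_elim
      case (elim G)
      note orth = face_embed_in_orthant[OF elim]
      have bound: "AE t in gamma_measure b. norm (ext_risk l (face_embed J G + t *\<^sub>R axis j 1)) \<le> (\<Sum>i\<in>J. G i) + t"
        using AE_gamma_measure_pos[of b]
      proof eventually_elim
        case (elim t)
        have "face_embed J G + t *\<^sub>R axis j 1 \<in> orthant" using orth elim by (auto simp: axis_def)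
        moreover have "total (face_embed J G + t *\<^sub>R axis j 1) = (\<Sum>i\<in>J. G i) + t"
          by (simp add: sum.distrib total_face_embed axis_def if_distrib[of "(*) _"] cong: if_cong)
        ultimately show ?case using abs_ext_risk_le by fastforce
      qed
      have "norm (\<integral>t. ext_risk l (face_embed J G + t *\<^sub>R axis j 1) \<partial>gamma_measure b)
          \<le> (\<integral>t. (\<Sum>i\<in>J. G i) + t \<partial>gamma_measure b)"
      proof (rule order_trans[OF integral_norm_bound integral_mono_AE[OF _ line_int bound]])
        show "integrable (gamma_measure b) (\<lambda>t. norm (ext_risk l (face_embed J G + t *\<^sub>R axis j 1)))"
          by (rule Bochner_Integration.integrable_bound[OF line_int[of "\<Sum>i\<in>J. G i"]])
             (use bound in \<open>auto elim!: eventually_mono\<close>)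
      qed
      also have "\<dots> = (\<Sum>i\<in>J. G i) + (\<integral>t. t \<partial>gamma_measure b)"
        using integrable_gamma_measure_ident[OF assms] by (simp add: b.prob_space[simplified])
      finally show ?case by simp
    qed
    show "(\<lambda>G. \<integral>t. ext_risk l (face_embed J G + t *\<^sub>R axis j 1) \<partial>gamma_measure b) \<in> borel_measurable (Pi\<^sub>M J M)"
      by measurable
  qed
qed

text \<open>Fubini isolates coordinate \<open>j\<close>, and on almost every line the
  one-dimensional integration by parts applies. If \<open>a j = 1\<close>, its boundary value at
  \<open>t = 0\<close> is the risk on the face spanned by \<open>J\<close>.\<close>

lemma integral_left_deriv:
  assumes j: "j \<notin> J" and aj: "1 \<le> a j"
  shows "(\<integral>G. left_deriv j (face_embed (insert j J) G) \<partial>Pi\<^sub>M (insert j J) M)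
    = (\<integral>G. ext_risk l (face_embed (insert j J) G) \<partial>Pi\<^sub>M (insert j J) M)
      - (if a j = 1 then \<integral>G. ext_risk l (face_embed J G) \<partial>Pi\<^sub>M J M
         else \<integral>G. \<integral>t. ext_risk l (face_embed J G + t *\<^sub>R axis j 1) \<partial>gamma_measure (a j - 1) \<partial>Pi\<^sub>M J M)"
proof -
  let ?A = "insert j J"
  interpret P: prob_space "Pi\<^sub>M ?A M" by (rule prob_space_product)
  let ?g = "\<lambda>G t. ext_risk l (face_embed J G + t *\<^sub>R axis j 1)"
  let ?B = "\<lambda>G. if a j = 1 then ext_risk l (face_embed J G) else \<integral>t. ?g G t \<partial>gamma_measure (a j - 1)"
  have B_int: "integrable (Pi\<^sub>M J M) ?B"
    using integral_ext_risk_dir(1)[of J] integrable_line_average[of "a j - 1" J j] aj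
    by (cases "a j = 1") simp_all
  have g_int: "integrable (Pi\<^sub>M J M) (\<lambda>G. \<integral>t. ?g G t \<partial>M j)"
    using shape_pos by (rule integrable_line_average)
  have "integrable (Pi\<^sub>M ?A M) (\<lambda>G. left_deriv j (face_embed ?A G))"
    by (rule P.integrable_const_bound[where B=1]) (use AE_left_deriv_product[OF j] in auto)
  hence "(\<integral>G. left_deriv j (face_embed ?A G) \<partial>Pi\<^sub>M ?A M)
      = (\<integral>G. \<integral>t. left_deriv j (face_embed ?A (G(j := t))) \<partial>M j \<partial>Pi\<^sub>M J M)"
    by (rule product_integral_insert[OF finite j])
  also have "\<dots> = (\<integral>G. (\<integral>t. ?g G t \<partial>M j) - ?B G \<partial>Pi\<^sub>M J M)"
  proof (rule integral_cong_AE)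
    show "AE G in Pi\<^sub>M J M. (\<integral>t. left_deriv j (face_embed ?A (G(j := t))) \<partial>M j) = (\<integral>t. ?g G t \<partial>M j) - ?B G"
      using AE_pos[of J, OF finite]
    proof eventually_elim
      case (elim G)
      note y = face_embed_in_orthant[OF elim]
      have yj: "face_embed J G $ j = 0" using j by (simp add: face_embed_nth)
      have lim: "AE t in M j. (\<lambda>k. (?g G t - ?g G (t / (1 + 1 / real (Suc k)))) / (t - t / (1 + 1 / real (Suc k))))
          \<longlonglongrightarrow> left_deriv j (face_embed J G + t *\<^sub>R axis j 1)"
        using AE_quotients_line[OF y yj, of "a j"] AE_gamma_measure_pos[of "a j"]
      proof eventually_elim
        case (elim t)
        note line = axis_line[OF y yj less_imp_le[OF elim(2)]]
        have X: "(\<lambda>k. left_quotient j (1 / real (Suc k)) (face_embed J G + t *\<^sub>R axis j 1))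
            \<longlonglongrightarrow> l (nrm (face_embed J G + t *\<^sub>R axis j 1)) (axis j 1)"
          using left_quotient_tendsto[OF line(1) _ elim(1)] line(2) elim(2) by simp
        hence "(\<lambda>k. left_quotient j (1 / real (Suc k)) (face_embed J G + t *\<^sub>R axis j 1))
            \<longlonglongrightarrow> left_deriv j (face_embed J G + t *\<^sub>R axis j 1)"
          unfolding left_deriv_def limI[OF X] .
        thus ?case by (simp only: left_quotient_line[OF y yj elim(2)])
      qed
      have lip: "\<bar>?g G t - ?g G t'\<bar> \<le> \<bar>t - t'\<bar>" for t t'
      proof -
        have "(\<Sum>i\<in>UNIV. \<bar>(face_embed J G + t *\<^sub>R axis j 1) $ i - (face_embed J G + t' *\<^sub>R axis j 1) $ i\<bar>)
            = (\<Sum>i\<in>UNIV. if i = j then \<bar>t - t'\<bar> else 0)"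
          by (intro sum.cong) (auto simp: axis_def)
        thus ?thesis using ext_risk_lipschitz[of "face_embed J G + t *\<^sub>R axis j 1" "face_embed J G + t' *\<^sub>R axis j 1"] by simp
      qed
      have "(\<integral>t. left_deriv j (face_embed J G + t *\<^sub>R axis j 1) \<partial>gamma_measure (a j))
          = (\<integral>t. ?g G t \<partial>gamma_measure (a j)) - (if a j = 1 then ?g G 0 else \<integral>t. ?g G t \<partial>gamma_measure (a j - 1))"
      proof (rule gamma_measure_difference_quotient[OF aj _ _ _ _ lim])
        show "\<bar>?g G t - ?g G 0\<bar> \<le> t" if "0 < t" for t using lip[of t 0] that by simp
        show "\<bar>(?g G t - ?g G (t / (1 + 1 / real (Suc k)))) / (t - t / (1 + 1 / real (Suc k)))\<bar> \<le> 1" for k t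
          unfolding abs_divide using lip by (intro divide_le_eq_1[THEN iffD2]) force
      qed measurable
      thus ?case unfolding face_embed_insert[OF j] by simp
    qed
  qed (use g_int B_int in \<open>auto simp: face_embed_insert[OF j] intro!: borel_measurable_diff\<close>)
  also have "\<dots> = (\<integral>G. \<integral>t. ?g G t \<partial>M j \<partial>Pi\<^sub>M J M) - (\<integral>G. ?B G \<partial>Pi\<^sub>M J M)"
    using g_int B_int by (rule Bochner_Integration.integral_diff)
  also have "(\<integral>G. \<integral>t. ?g G t \<partial>M j \<partial>Pi\<^sub>M J M) = (\<integral>G. ext_risk l (face_embed ?A G) \<partial>Pi\<^sub>M ?A M)"
    by (simp add: product_integral_insert[OF finite j integral_ext_risk_dir(1)] face_embed_insert[OF j])
  finally show ?thesis by (cases "a j = 1") simp_all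
qed

end

theorem lemma2:
  fixes l :: "real ^ 'k \<Rightarrow> real ^ 'k \<Rightarrow> real"
    and \<alpha> :: "real ^ 'k"
    and n :: real
    and j :: 'k
  assumes "bounded_loss l"
    and "proper_loss l"
    and "\<And>i. 0 \<le> \<alpha> $ i"
    and "n = (\<Sum>i\<in>UNIV. \<alpha> $ i)"
    and "\<alpha> $ j \<ge> 1"
  shows "integrable (dirichlet_completed \<alpha>) (\<lambda>p. l p (axis j 1))
    \<and> integrable (dirichlet_completed \<alpha>) (bayes_risk l)
    \<and> (n \<noteq> 1 \<longrightarrow> integrable (dirichlet_completed (\<alpha> - axis j 1)) (bayes_risk l))
    \<and> (\<integral>p. l p (axis j 1) \<partial>dirichlet_completed \<alpha>) =
        n * dirichlet_bayes_risk l \<alpha>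
        - (if n = 1 then 0 else (n - 1) * dirichlet_bayes_risk l (\<alpha> - axis j 1))"
proof -
  define \<beta> where "\<beta> = \<alpha> - axis j 1"
  have \<beta>_nth: "\<beta> $ i = (if i = j then \<alpha> $ j - 1 else \<alpha> $ i)" for i
    by (simp add: \<beta>_def axis_def)
  define A where "A = {i. 0 < \<alpha> $ i}"
  define B where "B = {i. 0 < \<beta> $ i}"
  define J where "J = A - {j}"
  have j: "j \<notin> J" and A: "A = insert j J"
    using assms(5) by (auto simp: J_def A_def)
  \<comment> \<open>The padding value 1 only serves positivity: the laws over \<open>A\<close> and
    \<open>B\<close> involve no index outside the supports.\<close>
  define a where "a i = (if 0 < \<alpha> $ i then \<alpha> $ i else 1)" for i
  define b where "b i = (if 0 < \<beta> $ i then \<beta> $ i else 1)" for i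
  interpret a: dirichlet_loss a l by unfold_locales (use assms in \<open>auto simp: a_def\<close>)
  interpret b: dirichlet_loss b l by unfold_locales (use assms in \<open>auto simp: b_def\<close>)
  have dir_\<alpha>: "dirichlet \<alpha> = a.dir A"
    unfolding A_def by (rule dirichlet_eq_distr) (simp add: a_def)
  have dir_\<beta>: "dirichlet \<beta> = b.dir B"
    unfolding B_def by (rule dirichlet_eq_distr) (simp add: b_def)
  have sum_a: "(\<Sum>i\<in>A. a i) = n"
    unfolding assms(4) by (rule sum.mono_neutral_cong_left)
      (use assms(3) in \<open>auto simp: A_def a_def not_less intro: antisym\<close>)
  have "(\<Sum>i\<in>B. b i) = (\<Sum>i\<in>UNIV. \<beta> $ i)"
    by (rule sum.mono_neutral_cong_left)
      (use assms(3,5) in \<open>auto simp: B_def b_def \<beta>_nth not_less intro: antisym split: if_splits\<close>)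
  also have "\<dots> = n - 1"
    by (simp add: assms(4) \<beta>_def sum_subtractf axis_def)
  finally have sum_b: "(\<Sum>i\<in>B. b i) = n - 1" .
  have "a j = \<alpha> $ j" using assms(5) by (simp add: a_def)
  have PiM_J: "(\<Pi>\<^sub>M i\<in>J. gamma_measure (a i)) = (\<Pi>\<^sub>M i\<in>J. gamma_measure (b i))"
    by (intro PiM_cong) (auto simp: J_def A_def a_def b_def \<beta>_nth)
  \<comment> \<open>Both forms of the subtracted term are one integral over \<open>B\<close>. If
    \<open>\<alpha> $ j = 1\<close>, coordinate \<open>j\<close> leaves the support and
    \<open>B = J\<close>; otherwise \<open>B = insert j J\<close>, and Fubini puts the lowered shape
    back into the product.\<close>
  have shifted: "(if a j = 1 then \<integral>G. ext_risk l (face_embed J G) \<partial>Pi\<^sub>M J a.M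
         else \<integral>G. \<integral>t. ext_risk l (face_embed J G + t *\<^sub>R axis j 1) \<partial>gamma_measure (a j - 1) \<partial>Pi\<^sub>M J a.M)
      = (\<integral>G. ext_risk l (face_embed B G) \<partial>Pi\<^sub>M B b.M)"
  proof (cases "\<alpha> $ j = 1")
    case True
    hence "B = J" by (auto simp: B_def J_def A_def \<beta>_nth)
    thus ?thesis using True \<open>a j = \<alpha> $ j\<close> PiM_J by simp
  next
    case False
    hence "B = insert j J" "b j = a j - 1"
      using assms(5) by (auto simp: B_def J_def A_def \<beta>_nth b_def a_def)
    thus ?thesis using False \<open>a j = \<alpha> $ j\<close> PiM_J
      by (simp add: b.product_integral_insert[OF finite j b.integral_ext_risk_dir(1)] face_embed_insert[OF j])
  qed
  have "(\<integral>p. l p (axis j 1) \<partial>completion (a.dir A))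
      = (\<integral>G. ext_risk l (face_embed A G) \<partial>Pi\<^sub>M A a.M) - (\<integral>G. ext_risk l (face_embed B G) \<partial>Pi\<^sub>M B b.M)"
    using a.loss_dir(2)[OF j] a.integral_left_deriv[OF j] assms(5) \<open>a j = \<alpha> $ j\<close> shifted
    unfolding A by simp
  also have "\<dots> = n * (\<integral>p. ext_risk l p \<partial>a.dir A) - (n - 1) * (\<integral>p. ext_risk l p \<partial>b.dir B)"
    unfolding a.integral_ext_risk_dir(2) b.integral_ext_risk_dir(2) sum_a sum_b ..
  also have "(\<integral>p. ext_risk l p \<partial>a.dir A) = dirichlet_bayes_risk l \<alpha>"
    unfolding dirichlet_bayes_risk_def dir_\<alpha> by (rule a.bayes_risk_dir(2)[symmetric]) (simp add: A)
  finally have eq: "(\<integral>p. l p (axis j 1) \<partial>completion (a.dir A))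
      = n * dirichlet_bayes_risk l \<alpha> - (n - 1) * (\<integral>p. ext_risk l p \<partial>b.dir B)" .
  \<comment> \<open>For \<open>n = 1\<close> the set \<open>B\<close> is empty and the factor
    \<open>n - 1\<close> removes the second term. Otherwise the shapes over \<open>B\<close> have
    nonzero sum, so the shifted Dirichlet law is meaningful.\<close>
  have B: "B \<noteq> {}" if "n \<noteq> 1" using that sum_b by auto
  have "(\<integral>p. ext_risk l p \<partial>b.dir B) = dirichlet_bayes_risk l \<beta>" if "n \<noteq> 1"
    unfolding dirichlet_bayes_risk_def dir_\<beta> by (rule b.bayes_risk_dir(2)[symmetric]) (rule B[OF that])
  with eq have "(\<integral>p. l p (axis j 1) \<partial>dirichlet_completed \<alpha>) = n * dirichlet_bayes_risk l \<alpha>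
        - (if n = 1 then 0 else (n - 1) * dirichlet_bayes_risk l \<beta>)"
    unfolding dir_\<alpha> by simp
  moreover have "integrable (dirichlet_completed \<alpha>) (\<lambda>p. l p (axis j 1))"
    unfolding dir_\<alpha> A by (rule a.loss_dir(1)[OF j])
  moreover have "integrable (dirichlet_completed \<alpha>) (bayes_risk l)"
    unfolding dir_\<alpha> by (rule a.bayes_risk_dir(1)) (simp add: A)
  moreover have "integrable (dirichlet_completed \<beta>) (bayes_risk l)" if "n \<noteq> 1"
    unfolding dir_\<beta> by (rule b.bayes_risk_dir(1)) (rule B[OF that])
  ultimately show ?thesis unfolding \<beta>_def by blast
qed

end
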